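(* Let $D$ be a logarithmic tract of $f$. Then for every sufficiently large $\rho>0$, the set $$A'(f,D)=\{z\in D:\ \exists L\in\mathbb{N}\text{ such that } f^n(z)\in D\text{ and }|f^{n+L}(z)|\ge M_D^n(\rho)\text{ for all }n\in\mathbb{N}\}$$ has upper box dimension equal to $2$.
   Context: A direct tract of $f$: $D$ is an unbounded domain in $\mathbb{C}$ whose boundary consists of piecewise smooth curves and whose complement is unbounded; $f$ is defined on $\overline D$ (not necessarily elsewhere), holomorphic in $D$, continuous on $\overline D$, and there is $R>0$ with $|f|=R$ on $\partial D$ and $|f|>R$ in $D$. It is a logarithmic tract if moreover $f:D\to\{z:|z|>R\}$ is a universal covering. $M_D(r)=\max_{|z|=r,z\in D}|f(z)|$ and $M_D^n$ is its $n$-th iterate. (The paper notes that $A'(f,D)$ does not depend on $\rho$ once $\rho$ is sufficiently large.) *)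

theory Defs
  imports "HOL-Complex_Analysis.Complex_Analysis"
begin

definition direct_tract :: "(complex \<Rightarrow> complex) \<Rightarrow> complex set \<Rightarrow> real \<Rightarrow> bool" where
  "direct_tract f D R \<longleftrightarrow>
     open D \<and> connected D \<and> \<not> bounded D \<and> \<not> bounded (- D) \<and>
     (\<exists>\<Gamma>. countable \<Gamma> \<and> (\<forall>g\<in>\<Gamma>. valid_path g) \<and> frontier D = \<Union> (path_image ` \<Gamma>)) \<and>
     R > 0 \<and> f holomorphic_on D \<and> continuous_on (closure D) f \<and>
     (\<forall>z\<in>frontier D. norm (f z) = R) \<and> (\<forall>z\<in>D. norm (f z) > R)"

text \<open>Logarithmic tract: moreover f : D \<rightarrow> {|w| > R} is a universal covering
(a covering map with simply connected total space).\<close>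
definition logarithmic_tract :: "(complex \<Rightarrow> complex) \<Rightarrow> complex set \<Rightarrow> real \<Rightarrow> bool" where
  "logarithmic_tract f D R \<longleftrightarrow>
     direct_tract f D R \<and> simply_connected D \<and> covering_space D f {w. norm w > R}"

definition max_mod_tract :: "(complex \<Rightarrow> complex) \<Rightarrow> complex set \<Rightarrow> real \<Rightarrow> real" where
  "max_mod_tract f D r = (SUP z \<in> {z \<in> D. norm z = r}. norm (f z))"

definition A'_set :: "(complex \<Rightarrow> complex) \<Rightarrow> complex set \<Rightarrow> real \<Rightarrow> complex set" where
  "A'_set f D \<rho> = {z \<in> D. \<exists>L::nat. \<forall>n::nat.
      (f ^^ n) z \<in> D \<and> norm ((f ^^ (n + L)) z) \<ge> ((max_mod_tract f D) ^^ n) \<rho>}"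

definition cover_num :: "complex set \<Rightarrow> real \<Rightarrow> nat" where
  "cover_num E \<delta> = (LEAST n. \<exists>C. finite C \<and> card C = n \<and> E \<subseteq> (\<Union>c\<in>C. cball c \<delta>))"

definition upper_box_dim_bdd :: "complex set \<Rightarrow> ereal" where
  "upper_box_dim_bdd E =
     Limsup (at_right 0) (\<lambda>\<delta>. ereal (ln (real (cover_num E \<delta>)) / - ln \<delta>))"

definition upper_box_dim :: "complex set \<Rightarrow> ereal" where
  "upper_box_dim E = (SUP r::real. upper_box_dim_bdd (E \<inter> cball 0 r))"

end

theory Submission
  imports Defs "HOL-Real_Asymp.Real_Asymp"
begin

text \<open>In logarithmic coordinates the tract is parametrised by a half-plane through \<open>\<phi>\<close> with
  \<open>f \<circ> \<phi> = exp\<close>, and \<open>G = log \<phi>\<close> satisfies \<open>|G'(w)| \<le> K / Re w\<close> because its image contains no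
  large disc. The set \<open>E = exp\<^sup>-\<^sup>1(A')\<close> is invariant under \<open>G\<close> and under translation by \<open>2\<pi>i\<close>;
  since \<open>\<phi>\<close> is proper, a single point of \<open>E\<close>, which is found by following points of maximum modulus,
  makes \<open>E\<close> relatively dense in a half-plane. Hence a disc of centre \<open>w\<close> and radius
  proportional to \<open>r = Re w\<close> contains about \<open>r\<^sup>2\<close> uniformly separated points of \<open>E\<close>.
  Along a horizontal ray \<open>G'\<close> cannot always be smaller than \<open>r\<^bsup>-1-\<epsilon>\<^esup>\<close>, since this is integrable while
  \<open>G\<close> is unbounded. So for arbitrarily large \<open>r\<close> such a disc can be pulled back, by a long composition of
  branches, into a fixed bounded region with derivative at least \<open>r\<^bsup>-1-\<epsilon>\<^esup>\<close> at the centre. By bounded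
  distortion, covering \<open>A'\<close> there at the scale \<open>r\<^bsup>-1-\<epsilon>\<^esup>\<close> takes about \<open>r\<^sup>2\<close> discs.\<close>

section \<open>Distortion of univalent functions\<close>

text \<open>Bloch's theorem puts a disc of radius \<open>r * norm (deriv h a) / 12\<close> into the
  image. If this exceeds \<open>pi\<close>, the disc contains two points differing by 2 pi i, where
  \<open>exp\<close> takes the same value.\<close>

lemma exp_inj_deriv_bound:
  assumes hol: "h holomorphic_on ball a r" and r: "0 < r"
    and inj: "inj_on (\<lambda>z. exp (h z)) (ball a r)"
  shows "r * norm (deriv h a) \<le> 12 * pi"
proof (rule ccontr)
  assume "\<not> ?thesis"
  then have gt: "pi < r * norm (deriv h a) / 12" by simp
  obtain b where b: "ball b (r * norm (deriv h a) / 12) \<subseteq> h ` ball a r"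
    using Bloch[OF hol r order_refl] by blast
  have "b + \<i> * pi \<in> h ` ball a r" "b - \<i> * pi \<in> h ` ball a r"
    using gt by (auto simp: dist_norm norm_mult intro!: subsetD[OF b])
  then obtain p q where p: "p \<in> ball a r" "h p = b + \<i> * pi" and q: "q \<in> ball a r" "h q = b - \<i> * pi"
    by (metis imageE)
  have "exp (h p) = exp (h q)"
    unfolding p q exp_add exp_diff by simp
  then have "p = q" using inj_onD[OF inj] p(1) q(1) by blast
  then show False using p q by simp
qed

text \<open>Otherwise the inverse of \<open>h\<close> would map a disc of radius
  \<open>2 * r * norm (deriv h a)\<close> about \<open>h a\<close> into \<open>ball a r\<close>, and
  Cauchy's estimate would make its derivative at \<open>h a\<close> at most half of what the chain
  rule demands.\<close>

lemma univalent_omits_near: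
  assumes hol: "h holomorphic_on ball a r" and r: "0 < r" and inj: "inj_on h (ball a r)"
  obtains w where "w \<notin> h ` ball a r" "norm (w - h a) \<le> 2 * r * norm (deriv h a)"
proof -
  have "\<exists>w. w \<notin> h ` ball a r \<and> norm (w - h a) \<le> 2 * r * norm (deriv h a)"
  proof (rule ccontr)
    assume neg: "\<not> ?thesis"
    define \<rho> where "\<rho> = 2 * r * norm (deriv h a)"
    obtain k where k: "k holomorphic_on (h ` ball a r)"
      "\<And>z. z \<in> ball a r \<Longrightarrow> deriv h z * deriv k (h z) = 1"
      "\<And>z. z \<in> ball a r \<Longrightarrow> k (h z) = z"
      using holomorphic_has_inverse[OF hol open_ball inj] by blast
    have d: "deriv h a * deriv k (h a) = 1" using k(2)[of a] r by simp
    then have nz: "deriv h a \<noteq> 0" by auto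
    have \<rho>: "\<rho> > 0" unfolding \<rho>_def using nz r by simp
    have sub: "cball (h a) \<rho> \<subseteq> h ` ball a r"
    proof
      fix w assume "w \<in> cball (h a) \<rho>"
      then have "norm (w - h a) \<le> 2 * r * norm (deriv h a)"
        by (simp add: \<rho>_def dist_norm norm_minus_commute)
      then show "w \<in> h ` ball a r" using neg by blast
    qed
    have "norm ((deriv ^^ 1) k (h a)) \<le> fact 1 * r / \<rho> ^ 1"
    proof (rule Cauchy_higher_deriv_bound)
      show "k holomorphic_on ball (h a) \<rho>"
        using k(1) sub ball_subset_cball holomorphic_on_subset by blast
      show "continuous_on (cball (h a) \<rho>) k"
        using k(1) sub holomorphic_on_imp_continuous_on continuous_on_subset by blast
      show "k w \<in> ball a r" if "w \<in> ball (h a) \<rho>" for w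
      proof -
        have "w \<in> h ` ball a r" using that sub ball_subset_cball by blast
        then show ?thesis using k(3) by auto
      qed
    qed (use \<rho> in auto)
    then have "norm (deriv k (h a)) * \<rho> \<le> r" using \<rho> by (simp add: field_simps)
    moreover have "norm (deriv h a) * norm (deriv k (h a)) = 1"
      using d by (metis norm_mult norm_one)
    ultimately show False using r unfolding \<rho>_def
      by (simp add: algebra_simps)
  qed
  then show ?thesis using that by blast
qed

text \<open>If \<open>w\<close> is omitted by \<open>h\<close>, then \<open>log (h - w)\<close> has an injective exponential, so
  its derivative is controlled by Bloch's theorem. This is a substitute for the sharp growth theorem.\<close>

lemma univalent_growth:
  assumes hol: "h holomorphic_on ball a r" and r: "0 < r" and inj: "inj_on h (ball a r)"
  obtains w where "\<And>z. z \<in> cball a (r/2) \<Longrightarrow> norm (h z - w) \<le> 2 * r * norm (deriv h a) * exp (12 * pi)"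
proof -
  obtain w where w: "w \<notin> h ` ball a r" "norm (w - h a) \<le> 2 * r * norm (deriv h a)"
    using univalent_omits_near[OF assms] by blast
  have "(\<lambda>z. h z - w) holomorphic_on ball a r" by (intro holomorphic_intros hol)
  moreover have "h z - w \<noteq> 0" if "z \<in> ball a r" for z using w(1) that by auto
  ultimately obtain l where l: "l holomorphic_on ball a r" "\<And>z. z \<in> ball a r \<Longrightarrow> h z - w = exp (l z)"
    using contractible_imp_holomorphic_log[of "\<lambda>z. h z - w" "ball a r"] convex_imp_contractible[OF convex_ball]
    by metis
  have dl: "norm (deriv l z) \<le> 24 * pi / r" if z: "z \<in> cball a (r/2)" for z
  proof -
    have sub: "ball z (r/2) \<subseteq> ball a r"
    proof
      fix x assume "x \<in> ball z (r/2)"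
      then show "x \<in> ball a r" using z dist_triangle[of a x z] by simp
    qed
    have "(r/2) * norm (deriv l z) \<le> 12 * pi"
    proof (rule exp_inj_deriv_bound)
      show "l holomorphic_on ball z (r/2)" using l(1) sub holomorphic_on_subset by blast
      show "inj_on (\<lambda>z. exp (l z)) (ball z (r / 2))"
      proof (rule inj_onI)
        fix x y assume xy: "x \<in> ball z (r/2)" "y \<in> ball z (r/2)" "exp (l x) = exp (l y)"
        then have "x \<in> ball a r" "y \<in> ball a r" using sub by auto
        then have "h x = h y" using l(2) xy(3) by (metis diff_eq_eq diff_add_cancel)
        then show "x = y" using inj \<open>x \<in> ball a r\<close> \<open>y \<in> ball a r\<close> by (auto dest: inj_onD)
      qed
    qed (use r in simp)
    then show ?thesis using r by (simp add: field_simps)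
  qed
  have "norm (h z - w) \<le> 2 * r * norm (deriv h a) * exp (12 * pi)" if z: "z \<in> cball a (r/2)" for z
  proof -
    have sub: "cball a (r/2) \<subseteq> ball a r" using r by auto
    have "norm (l z - l a) \<le> 24 * pi / r * norm (z - a)"
    proof (rule field_differentiable_bound[OF convex_cball])
      fix u assume u: "u \<in> cball a (r/2)"
      show "(l has_field_derivative deriv l u) (at u within cball a (r/2))"
        using l(1) u sub by (meson holomorphic_derivI open_ball subsetD)
      show "norm (deriv l u) \<le> 24 * pi / r" by (rule dl[OF u])
    qed (use z r in auto)
    also have "\<dots> \<le> 24 * pi / r * (r/2)"
      using z r by (intro mult_left_mono) (auto simp: dist_norm norm_minus_commute)
    finally have le: "norm (l z - l a) \<le> 12 * pi" using r by simp
    \<comment> \<open>The logarithm varies by at most \<open>12 * pi\<close> on the half disc, so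
      the distance to the omitted value changes by a bounded factor.\<close>
    have "h z - w = (h a - w) * exp (l z - l a)"
      using l(2)[of a] l(2)[of z] z sub r by (auto simp: exp_diff)
    then have "norm (h z - w) = norm (h a - w) * exp (Re (l z - l a))"
      by (metis norm_mult norm_exp_eq_Re)
    also have "\<dots> \<le> (2 * r * norm (deriv h a)) * exp (12 * pi)"
    proof (rule mult_mono)
      show "exp (Re (l z - l a)) \<le> exp (12 * pi)"
        using le complex_Re_le_cmod[of "l z - l a"] by (simp del: minus_complex.simps)
    qed (use w(2) r in \<open>auto simp: norm_minus_commute\<close>)
    finally show ?thesis .
  qed
  then show ?thesis using that by blast
qed

text \<open>Chosen so that the final estimate in \<open>univalent_distortion\<close> is exactly half
  of \<open>norm (deriv h a)\<close>.\<close>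

definition distortion_radius :: real where
  "distortion_radius = 1 / (256 * exp (12 * pi))"

lemma distortion_radius: "0 < distortion_radius" "distortion_radius < 1/4"
proof -
  show "0 < distortion_radius" by (simp add: distortion_radius_def)
  have "exp (12 * pi) \<ge> (1::real)" by simp
  then have "256 * exp (12 * pi) > (4::real)" by linarith
  then show "distortion_radius < 1/4"
    unfolding distortion_radius_def by (simp add: field_simps)
qed

text \<open>A weak form of Koebe distortion: the growth bound and Cauchy's estimate on discs of
  radius \<open>r / 4\<close> control the second derivative, which is then integrated from
  \<open>a\<close>.\<close>

lemma univalent_distortion:
  assumes hol: "h holomorphic_on ball a r" and r: "0 < r" and inj: "inj_on h (ball a r)"
    and z: "z \<in> ball a (distortion_radius * r)"
  shows "norm (deriv h z - deriv h a) \<le> norm (deriv h a) / 2"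
proof -
  define B where "B = 2 * r * norm (deriv h a) * exp (12 * pi)"
  obtain w where w: "\<And>z. z \<in> cball a (r/2) \<Longrightarrow> norm (h z - w) \<le> B"
    using univalent_growth[OF hol r inj] unfolding B_def by blast
  have nz: "deriv h a \<noteq> 0"
    using holomorphic_injective_imp_regular[OF hol open_ball inj, of a] r by simp
  have B: "B > 0" unfolding B_def using r nz by simp
  have h2: "norm ((deriv ^^ 2) h u) \<le> 64 * B / r^2" if u: "u \<in> ball a (r/4)" for u
  proof -
    have sub: "cball u (r/4) \<subseteq> cball a (r/2)"
    proof
      fix x assume "x \<in> cball u (r/4)"
      then show "x \<in> cball a (r/2)" using u dist_triangle[of a x u] by simp
    qed
    have sub': "cball a (r/2) \<subseteq> ball a r" using r by auto
    \<comment> \<open>\<open>2*B\<close> rather than \<open>B\<close>: Cauchy's estimate wants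
      values in an open disc, while the growth bound is not strict.\<close>
    have "norm ((deriv ^^ 2) h u) \<le> fact 2 * (2*B) / (r/4) ^ 2"
    proof (rule Cauchy_higher_deriv_bound)
      show "h holomorphic_on ball u (r/4)"
        using hol sub sub' ball_subset_cball holomorphic_on_subset by (metis (full_types))
      show "continuous_on (cball u (r/4)) h"
        using hol sub sub' holomorphic_on_imp_continuous_on continuous_on_subset by metis
      show "h v \<in> ball w (2*B)" if "v \<in> ball u (r/4)" for v
      proof -
        have "v \<in> cball a (r/2)" using that sub ball_subset_cball by blast
        from w[OF this] show ?thesis using B by (simp add: dist_norm norm_minus_commute)
      qed
    qed (use r in auto)
    then show ?thesis by (simp add: field_simps)
  qed
  have ss: "ball a (distortion_radius * r) \<subseteq> ball a (r/4)"
    using distortion_radius r by (intro subset_ball) simp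
  have "norm (deriv h z - deriv h a) \<le> 64 * B / r^2 * norm (z - a)"
  proof (rule field_differentiable_bound[OF convex_ball])
    fix u assume u: "u \<in> ball a (distortion_radius * r)"
    then have "u \<in> ball a (r/4)" using ss by blast
    then have "u \<in> ball a r" using r by auto
    have "deriv h holomorphic_on ball a r" by (intro holomorphic_deriv hol open_ball)
    from holomorphic_derivI[OF this open_ball \<open>u \<in> ball a r\<close>]
    show "(deriv h has_field_derivative (deriv ^^ 2) h u) (at u within ball a (distortion_radius * r))"
      by (simp add: numeral_2_eq_2)
    show "norm ((deriv ^^ 2) h u) \<le> 64 * B / r^2" by (rule h2) fact
  qed (use z r distortion_radius in auto)
  also have "\<dots> \<le> 64 * B / r^2 * (distortion_radius * r)"
    using z B r by (intro mult_left_mono) (auto simp: dist_norm norm_minus_commute)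
  also have "\<dots> = norm (deriv h a) / 2"
    unfolding B_def distortion_radius_def using r by (simp add: field_simps power2_eq_square)
  finally show ?thesis .
qed

corollary univalent_deriv_lower:
  assumes "h holomorphic_on ball a r" "0 < r" "inj_on h (ball a r)"
    and "z \<in> ball a (distortion_radius * r)"
  shows "norm (deriv h a) / 2 \<le> norm (deriv h z)"
proof -
  have "norm (deriv h a) \<le> norm (deriv h z) + norm (deriv h z - deriv h a)"
    by (metis norm_triangle_sub norm_minus_commute)
  then show ?thesis using univalent_distortion[OF assms] by linarith
qed

text \<open>After subtracting the linear part \<open>deriv h a * z\<close>, the remainder has
  Lipschitz constant at most half of \<open>norm (deriv h a)\<close>, so the linear part
  dominates.\<close>

corollary univalent_separation:
  assumes hol: "h holomorphic_on ball a r" and r: "0 < r" and inj: "inj_on h (ball a r)"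
    and pq: "p \<in> ball a (distortion_radius * r)" "q \<in> ball a (distortion_radius * r)"
  shows "norm (deriv h a) / 2 * norm (p - q) \<le> norm (h p - h q)"
proof -
  define k where "k = (\<lambda>z. h z - deriv h a * z)"
  have ss: "ball a (distortion_radius * r) \<subseteq> ball a r"
    using distortion_radius r by (intro subset_ball) (simp add: mult_le_cancel_right1)
  have "norm (k p - k q) \<le> norm (deriv h a) / 2 * norm (p - q)"
  proof (rule field_differentiable_bound[OF convex_ball])
    fix u assume u: "u \<in> ball a (distortion_radius * r)"
    have "(h has_field_derivative deriv h u) (at u within ball a (distortion_radius * r))"
      using hol u ss by (meson holomorphic_derivI open_ball subsetD)
    then show "(k has_field_derivative (deriv h u - deriv h a)) (at u within ball a (distortion_radius * r))"
      unfolding k_def by (auto intro!: derivative_eq_intros)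
    show "norm (deriv h u - deriv h a) \<le> norm (deriv h a) / 2"
      by (rule univalent_distortion[OF hol r inj u])
  qed (use pq in auto)
  moreover have "deriv h a * (p - q) = (h p - h q) - (k p - k q)"
    by (simp add: k_def algebra_simps)
  then have "norm (deriv h a) * norm (p - q) \<le> norm (h p - h q) + norm (k p - k q)"
    by (metis norm_mult norm_triangle_ineq4)
  ultimately show ?thesis by (simp add: algebra_simps)
qed

section \<open>Logarithmic coordinates on a logarithmic tract\<close>

text \<open>The universal cover of the exterior of a disc is also realised by \<open>exp\<close> on a half-plane, so
  lifting each map through the other gives mutually inverse maps between \<open>D\<close> and that half-plane.\<close>

lemma logarithmic_tract_lift:
  assumes "logarithmic_tract f D R"
  obtains \<phi> g where "\<phi> holomorphic_on {w. ln R < Re w}" "\<phi> ` {w. ln R < Re w} = D"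
    "g holomorphic_on D" "\<And>z. z \<in> D \<Longrightarrow> exp (g z) = f z"
    "\<And>w. ln R < Re w \<Longrightarrow> g (\<phi> w) = w" "\<And>w. ln R < Re w \<Longrightarrow> f (\<phi> w) = exp w"
    "\<And>z. z \<in> D \<Longrightarrow> ln R < Re (g z)" "\<And>z. z \<in> D \<Longrightarrow> \<phi> (g z) = z"
proof -
  define H where "H = {w. ln R < Re w}"
  have op: "open D" and conn: "connected D" and holf: "f holomorphic_on D" and R: "R > 0"
    and ub: "\<not> bounded D"
    and fD: "\<And>z. z \<in> D \<Longrightarrow> norm (f z) > R"
    and sc: "simply_connected D" and cov: "covering_space D f {w. norm w > R}"
    using assms unfolding logarithmic_tract_def direct_tract_def by auto
  have openH: "open H" and convH: "convex H"
    unfolding H_def by (simp_all add: open_halfspace_Re_gt convex_halfspace_Re_gt)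
  have fnz: "f z \<noteq> 0" if "z \<in> D" for z using fD[OF that] R by auto
  obtain g0 where g0: "g0 holomorphic_on D" "\<And>z. z \<in> D \<Longrightarrow> f z = exp (g0 z)"
    using simply_connected_imp_holomorphic_log[OF holf sc open_imp_locally_path_connected[OF op] fnz]
    by blast
  have g0H: "g0 z \<in> H" if "z \<in> D" for z
  proof -
    have "exp (ln R) < exp (Re (g0 z))" using fD[OF that] g0(2)[OF that] R by simp
    then show ?thesis unfolding H_def by simp
  qed
  obtain z0 where z0: "z0 \<in> D" using ub by fastforce
  have expH: "norm (exp w) > R" if "w \<in> H" for w
  proof -
    have "exp (ln R) < exp (Re w)" using that unfolding H_def by simp
    then show ?thesis using R by simp
  qed
  \<comment> \<open>The lift of \<open>exp\<close> through the covering \<open>f\<close> with base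
    point \<open>g0 z0\<close> sent to \<open>z0\<close>.\<close>
  obtain \<phi> where \<phi>: "continuous_on H \<phi>" "\<phi> \<in> H \<rightarrow> D" "\<phi> (g0 z0) = z0" "\<And>w. w \<in> H \<Longrightarrow> f (\<phi> w) = exp w"
  proof (rule covering_space_lift_strong[OF cov z0 g0H[OF z0]])
    show "simply_connected H" using convH convex_imp_simply_connected by blast
    show "locally path_connected H" using openH open_imp_locally_path_connected by blast
    show "continuous_on H exp" by (intro continuous_intros)
    show "exp \<in> H \<rightarrow> {w. norm w > R}" using expH by auto
    show "exp (g0 z0) = f z0" using g0(2)[OF z0] by simp
  qed blast
  \<comment> \<open>Both sides lift \<open>exp\<close> through the covering \<open>exp\<close> and
    agree at \<open>g0 z0\<close>.\<close>
  have gp: "g0 (\<phi> w) = w" if w: "w \<in> H" for w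
  proof (rule covering_space_lift_unique[OF covering_space_exp_punctured_plane, of "\<lambda>w. g0 (\<phi> w)" "g0 z0" "\<lambda>w. w" H exp])
    show "continuous_on H (\<lambda>w. g0 (\<phi> w))"
      by (rule continuous_on_compose2[OF holomorphic_on_imp_continuous_on[OF g0(1)] \<phi>(1)])
        (use \<phi>(2) in auto)
    show "exp x = exp (g0 (\<phi> x))" if "x \<in> H" for x
      using \<phi>(2,4) g0(2) that by (metis Pi_mem)
  qed (use \<phi> w convex_connected[OF convH] g0H[OF z0] in \<open>auto intro!: continuous_intros\<close>)
  \<comment> \<open>Both sides lift \<open>f\<close> through the covering \<open>f\<close> and agree
    at \<open>z0\<close>.\<close>
  have pg: "\<phi> (g0 z) = z" if z: "z \<in> D" for z
  proof (rule covering_space_lift_unique[OF cov, of "\<lambda>w. \<phi> (g0 w)" "z0" "\<lambda>w. w" D f])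
    show "continuous_on D (\<lambda>w. \<phi> (g0 w))"
      by (rule continuous_on_compose2[OF \<phi>(1) holomorphic_on_imp_continuous_on[OF g0(1)]])
        (use g0H in auto)
    show "f x = f (\<phi> (g0 x))" if "x \<in> D" for x
      using \<phi>(4) g0H g0(2) that by metis
    show "f \<in> D \<rightarrow> {w. norm w > R}" using fD by auto
    show "(\<lambda>w. \<phi> (g0 w)) \<in> D \<rightarrow> D" using \<phi>(2) g0H by auto
  qed (use z z0 \<phi> conn holomorphic_on_imp_continuous_on[OF holf] in \<open>auto intro!: continuous_intros\<close>)
  \<comment> \<open>Lifting gives continuity only. Holomorphy of \<open>\<phi>\<close> comes from
    identifying it with the holomorphic inverse of the injective \<open>g0\<close>.\<close>
  have "inj_on g0 D" using pg by (metis inj_onI)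
  then obtain k where k: "k holomorphic_on (g0 ` D)" "\<And>z. z \<in> D \<Longrightarrow> k (g0 z) = z"
    using holomorphic_has_inverse[OF g0(1) op] by metis
  have im: "g0 ` D = H"
    using g0H gp \<phi>(2) by (force simp: image_iff Pi_iff)
  have "k w = \<phi> w" if "w \<in> H" for w
    using that k(2) gp \<phi>(2) by (metis Pi_mem)
  then have hol\<phi>: "\<phi> holomorphic_on H"
    using k(1) im holomorphic_transform by metis
  have "\<phi> ` H = D" using pg g0H \<phi>(2) by (force simp: image_iff Pi_iff)
  then show ?thesis
    using that[of \<phi> g0] hol\<phi> g0 gp \<phi>(4) g0H pg unfolding H_def by auto
qed

text \<open>The disc version is applied to the largest disc about \<open>w\<close> inside the
  half-plane.\<close>

lemma inj_exp_deriv_bound_halfplane: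
  assumes hol: "G holomorphic_on {w. T < Re w}" and inj: "inj_on (\<lambda>w. exp (G w)) {w. T < Re w}"
    and w: "T < Re w"
  shows "norm (deriv G w) \<le> 12 * pi / (Re w - T)"
proof -
  have sub: "ball w (Re w - T) \<subseteq> {w. T < Re w}"
  proof
    fix v assume "v \<in> ball w (Re w - T)"
    then show "v \<in> {w. T < Re w}"
      using complex_Re_le_cmod[of "w - v"] by (simp add: dist_norm)
  qed
  have "(Re w - T) * norm (deriv G w) \<le> 12 * pi"
  proof (rule exp_inj_deriv_bound)
    show "G holomorphic_on ball w (Re w - T)" using hol sub holomorphic_on_subset by blast
    show "inj_on (\<lambda>w. exp (G w)) (ball w (Re w - T))" using inj sub inj_on_subset by blast
  qed (use w in simp)
  then show ?thesis using w by (simp add: field_simps)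
qed

text \<open>\<open>G\<close> is a branch of the inverse of the logarithmic transform of \<open>f\<close>. The threshold \<open>T\<close> keeps
  \<open>\<phi>\<close> away from \<open>0\<close>.\<close>

locale log_coordinates =
  fixes f :: "complex \<Rightarrow> complex" and D :: "complex set" and \<phi> G :: "complex \<Rightarrow> complex" and T K :: real
  assumes T: "1 \<le> T" and K: "1 \<le> K"
    and G_hol: "G holomorphic_on {w. T < Re w}"
    and exp_G: "T < Re w \<Longrightarrow> exp (G w) = \<phi> w"
    and \<phi>_inj: "inj_on \<phi> {w. T < Re w}"
    and \<phi>_mem: "T < Re w \<Longrightarrow> \<phi> w \<in> D"
    and f_\<phi>: "T < Re w \<Longrightarrow> f (\<phi> w) = exp w"
    and G_deriv: "T < Re w \<Longrightarrow> norm (deriv G w) \<le> K / Re w"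
    and \<phi>_proper: "bounded {w. T < Re w \<and> norm (\<phi> w) \<le> B}"
    and \<phi>_onto: "z \<in> D \<Longrightarrow> exp T < norm (f z) \<Longrightarrow> \<exists>w. T < Re w \<and> \<phi> w = z"
    and max_mod_upper: "z \<in> D \<Longrightarrow> norm (f z) \<le> max_mod_tract f D (norm z)"
    and max_mod_attained: "z \<in> D \<Longrightarrow> \<exists>z'\<in>D. norm z' = norm z \<and> max_mod_tract f D (norm z) = norm (f z')"

text \<open>The part of the circle in \<open>D\<close> need not be compact, so the maximum is taken
  over the closure. It exceeds \<open>R\<close>, hence is not attained on the frontier.\<close>

lemma max_mod_tract_attained:
  assumes "direct_tract f D R" and z: "z \<in> D"
  obtains z' where "z' \<in> D" "norm z' = norm z" "max_mod_tract f D (norm z) = norm (f z')"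
    "norm (f z) \<le> norm (f z')"
proof -
  have op: "open D" and contf: "continuous_on (closure D) f"
    and bd: "\<And>z. z \<in> frontier D \<Longrightarrow> norm (f z) = R" and fD: "\<And>z. z \<in> D \<Longrightarrow> norm (f z) > R"
    using assms unfolding direct_tract_def by auto
  define C where "C = closure D \<inter> sphere 0 (norm z)"
  have "compact C" unfolding C_def by (intro closed_Int_compact) auto
  moreover have zC: "z \<in> C" unfolding C_def using z closure_subset by auto
  moreover have "continuous_on C (\<lambda>z. norm (f z))"
    unfolding C_def by (intro continuous_on_norm continuous_on_subset[OF contf]) auto
  ultimately obtain z' where z': "z' \<in> C" "\<And>y. y \<in> C \<Longrightarrow> norm (f y) \<le> norm (f z')"
    using continuous_attains_sup[of C "\<lambda>z. norm (f z)"] by blast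
  have "norm (f z') > R" using z'(2)[OF zC] fD[OF z] by linarith
  then have "z' \<notin> frontier D" using bd by force
  then have z'D: "z' \<in> D" using z'(1) op by (auto simp: C_def frontier_def interior_open)
  have nz': "norm z' = norm z" using z'(1) by (simp add: C_def)
  have "max_mod_tract f D (norm z) = norm (f z')"
    unfolding max_mod_tract_def
  proof (rule cSup_eq_maximum)
    show "norm (f z') \<in> (\<lambda>z. norm (f z)) ` {u \<in> D. norm u = norm z}" using z'D nz' by blast
    show "x \<le> norm (f z')" if "x \<in> (\<lambda>z. norm (f z)) ` {u \<in> D. norm u = norm z}" for x
      using that z'(2) closure_subset[of D] by (auto simp: C_def)
  qed
  then show ?thesis using that z'D nz' z'(2)[OF zC] by blast
qed

lemma logarithmic_tract_coordinates:
  assumes lt: "logarithmic_tract f D R"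
  obtains \<phi> G T K where "log_coordinates f D \<phi> G T K"
proof -
  have op: "open D" and R: "R > 0" and contf: "continuous_on (closure D) f"
    and bd: "\<And>z. z \<in> frontier D \<Longrightarrow> norm (f z) = R"
    using lt unfolding logarithmic_tract_def direct_tract_def by auto
  obtain \<phi> g where \<phi>: "\<phi> holomorphic_on {w. ln R < Re w}" "\<phi> ` {w. ln R < Re w} = D"
    and g: "g holomorphic_on D" "\<And>z. z \<in> D \<Longrightarrow> exp (g z) = f z"
    and gp: "\<And>w. ln R < Re w \<Longrightarrow> g (\<phi> w) = w" and fp: "\<And>w. ln R < Re w \<Longrightarrow> f (\<phi> w) = exp w"
    and gD: "\<And>z. z \<in> D \<Longrightarrow> ln R < Re (g z)" and pg: "\<And>z. z \<in> D \<Longrightarrow> \<phi> (g z) = z"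
    using logarithmic_tract_lift[OF lt] by blast
  \<comment> \<open>The bound by \<open>ln (norm (f 0))\<close> excludes
    \<open>\<phi> w = 0\<close>, which would force \<open>norm (f 0) = exp (Re w)\<close>; thus
    \<open>\<phi>\<close> has a logarithm.\<close>
  define S where "S = max 1 (max (ln R + 1) (ln (norm (f 0))))"
  have S: "1 \<le> S" "ln R < S" "ln (norm (f 0)) \<le> S" by (auto simp: S_def)
  have nz: "\<phi> w \<noteq> 0" if w: "S < Re w" for w
  proof
    assume "\<phi> w = 0"
    then have "f 0 = exp w" using fp[of w] w S by simp
    then have "ln (norm (f 0)) = Re w" by simp
    then show False using w S by linarith
  qed
  have sub: "{w. S < Re w} \<subseteq> {w. ln R < Re w}" using S by auto
  obtain G where G: "G holomorphic_on {w. S < Re w}" "\<And>w. w \<in> {w. S < Re w} \<Longrightarrow> \<phi> w = exp (G w)"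
    using contractible_imp_holomorphic_log[OF holomorphic_on_subset[OF \<phi>(1) sub]
        convex_imp_contractible[OF convex_halfspace_Re_gt]] nz by auto
  have inj: "inj_on \<phi> {w. S < Re w}"
    using gp S by (intro inj_onI) (metis mem_Collect_eq less_trans)
  then have injG: "inj_on (\<lambda>w. exp (G w)) {w. S < Re w}"
    using G(2) by (simp add: inj_on_def)
  \<comment> \<open>Doubling the threshold gives \<open>Re w - S \<ge> Re w / 2\<close>, which turns
    the bound \<open>12 * pi / (Re w - S)\<close> into \<open>24 * pi / Re w\<close>.\<close>
  have "log_coordinates f D \<phi> G (2 * S) (24 * pi)"
  proof
    show "1 \<le> 24 * pi" using pi_gt3 by simp
    show "norm (deriv G w) \<le> 24 * pi / Re w" if w: "2 * S < Re w" for w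
    proof -
      have "norm (deriv G w) \<le> 12 * pi / (Re w - S)"
        using inj_exp_deriv_bound_halfplane[OF G(1) injG] w S by simp
      also have "\<dots> \<le> 12 * pi / (Re w / 2)"
        using w S by (intro divide_left_mono) auto
      finally show ?thesis by simp
    qed
    show "bounded {w. 2 * S < Re w \<and> norm (\<phi> w) \<le> B}" for B
    proof -
      \<comment> \<open>Points of the closure with \<open>norm (f z) \<ge> exp S > R\<close> are off
        the frontier, so \<open>C\<close> is a compact subset of \<open>D\<close> and
        \<open>g\<close> is bounded on it.\<close>
      define C where "C = closure D \<inter> f -` {z. exp S \<le> norm z} \<inter> cball 0 B"
      have "exp (ln R) < exp S" using S by simp
      then have ES: "R < exp S" using R by simp
      have "closed {z::complex. exp S \<le> norm z}"
        by (intro closed_Collect_le continuous_intros)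
      then have "closed (closure D \<inter> f -` {z. exp S \<le> norm z})"
        using continuous_closed_preimage[OF contf closed_closure] by blast
      then have "compact C" unfolding C_def by (intro closed_Int_compact compact_cball)
      moreover have CD: "C \<subseteq> D"
      proof
        fix z assume z: "z \<in> C"
        then have "z \<notin> frontier D" using bd[of z] ES by (auto simp: C_def)
        then show "z \<in> D" using z op by (auto simp: C_def frontier_def interior_open)
      qed
      then have "continuous_on C g"
        using g(1) holomorphic_on_imp_continuous_on continuous_on_subset by blast
      ultimately have "bounded (g ` C)" using compact_continuous_image compact_imp_bounded by blast
      moreover have "{w. 2 * S < Re w \<and> norm (\<phi> w) \<le> B} \<subseteq> g ` C"
      proof
        fix w assume w: "w \<in> {w. 2 * S < Re w \<and> norm (\<phi> w) \<le> B}"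
        then have "ln R < Re w" "S \<le> Re w" using S by auto
        then have "\<phi> w \<in> D" "norm (f (\<phi> w)) = exp (Re w)" "g (\<phi> w) = w"
          using \<phi>(2) fp gp by auto
        then have "\<phi> w \<in> C" unfolding C_def
          using w \<open>S \<le> Re w\<close> closure_subset[of D] by auto
        then show "w \<in> g ` C" using \<open>g (\<phi> w) = w\<close> by (metis image_eqI)
      qed
      ultimately show ?thesis using bounded_subset by blast
    qed
    show "\<exists>w. 2 * S < Re w \<and> \<phi> w = z" if "z \<in> D" "exp (2 * S) < norm (f z)" for z
    proof (intro exI conjI)
      have "exp (2 * S) < exp (Re (g z))" using that g(2)[of z] by (metis norm_exp_eq_Re)
      then show "2 * S < Re (g z)" by simp
    qed (use pg that in auto)
    show "inj_on \<phi> {w. 2 * S < Re w}" using inj S by (auto simp: inj_on_def)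
    show "G holomorphic_on {w. 2 * S < Re w}"
      by (rule holomorphic_on_subset[OF G(1)]) (use S in auto)
    show "\<phi> w \<in> D" if "2 * S < Re w" for w using \<phi>(2) that S by force
    show "f (\<phi> w) = exp w" if "2 * S < Re w" for w using fp that S by simp
    have dt: "direct_tract f D R" using lt by (simp add: logarithmic_tract_def)
    show "norm (f z) \<le> max_mod_tract f D (norm z)" if "z \<in> D" for z
      using max_mod_tract_attained[OF dt that] by metis
    show "\<exists>z'\<in>D. norm z' = norm z \<and> max_mod_tract f D (norm z) = norm (f z')" if "z \<in> D" for z
      using max_mod_tract_attained[OF dt that] by metis
  qed (use S G(2) in auto)
  then show ?thesis using that by blast
qed

section \<open>Box dimension\<close>

text \<open>A square grid of mesh \<open>\<delta>\<close> serves: rounding moves each coordinate by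
  at most \<open>\<delta> / 2\<close>.\<close>

lemma exists_finite_cover:
  assumes \<delta>: "0 < \<delta>" and E: "E \<subseteq> cball 0 r" and r: "0 \<le> r"
  obtains C :: "complex set" where "finite C" "real (card C) \<le> (2 * r / \<delta> + 3)^2" "E \<subseteq> (\<Union>c\<in>C. cball c \<delta>)"
proof -
  define N where "N = \<lfloor>r / \<delta>\<rfloor> + 1"
  have N: "r / \<delta> < N" "N \<le> r / \<delta> + 1" "0 \<le> N" unfolding N_def using r \<delta> by (auto; linarith)+
  define h where "h = (\<lambda>(a::int, b::int). Complex (\<delta> * a) (\<delta> * b))"
  define C where "C = h ` ({-N..N} \<times> {-N..N})"
  have "finite C" unfolding C_def by simp
  moreover have "real (card C) \<le> (2 * r / \<delta> + 3)^2"
  proof -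
    have "card C \<le> card ({-N..N} \<times> {-N..N})" unfolding C_def by (intro card_image_le) simp
    also have "\<dots> = nat (2 * N + 1) ^ 2" by (simp add: card_cartesian_product power2_eq_square)
    finally have "real (card C) \<le> real (nat (2 * N + 1)) ^ 2" by (metis of_nat_le_iff of_nat_power)
    also have "\<dots> = (2 * real_of_int N + 1) ^ 2" using N(3) by simp
    also have "\<dots> \<le> (2 * r / \<delta> + 3)^2" using N by (intro power_mono) auto
    finally show ?thesis .
  qed
  moreover have "E \<subseteq> (\<Union>c\<in>C. cball c \<delta>)"
  proof
    fix z assume "z \<in> E"
    then have z: "norm z \<le> r" using E by auto
    define a where "a = round (Re z / \<delta>)"
    define b where "b = round (Im z / \<delta>)"
    have ab: "\<bar>a - Re z / \<delta>\<bar> \<le> 1/2" "\<bar>b - Im z / \<delta>\<bar> \<le> 1/2"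
      unfolding a_def b_def by (rule of_int_round_abs_le)+
    have rd: "\<bar>Re z / \<delta>\<bar> \<le> r / \<delta>" "\<bar>Im z / \<delta>\<bar> \<le> r / \<delta>"
      using z abs_Re_le_cmod[of z] abs_Im_le_cmod[of z] \<delta> by (auto simp: divide_right_mono)
    have "\<bar>real_of_int a\<bar> < N + 1" "\<bar>real_of_int b\<bar> < N + 1" using ab rd N by linarith+
    then have "\<bar>a\<bar> \<le> N" "\<bar>b\<bar> \<le> N" by linarith+
    then have "h (a, b) \<in> C" unfolding C_def by (intro imageI) auto
    moreover have "z \<in> cball (h (a, b)) \<delta>"
    proof -
      have "\<bar>\<delta> * a - Re z\<bar> = \<delta> * \<bar>a - Re z / \<delta>\<bar>" "\<bar>\<delta> * b - Im z\<bar> = \<delta> * \<bar>b - Im z / \<delta>\<bar>"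
        using \<delta> by (simp_all add: abs_if field_simps)
      then have "\<bar>\<delta> * a - Re z\<bar> \<le> \<delta> * (1/2)" "\<bar>\<delta> * b - Im z\<bar> \<le> \<delta> * (1/2)"
        using ab \<delta> by (metis mult_left_mono less_imp_le)+
      then have "norm (h (a, b) - z) \<le> \<delta>"
        using cmod_le[of "h (a, b) - z"] by (simp add: h_def)
      then show ?thesis by (simp add: dist_norm)
    qed
    ultimately show "z \<in> (\<Union>c\<in>C. cball c \<delta>)" by blast
  qed
  ultimately show ?thesis using that by blast
qed

lemma cover_num_le:
  assumes "0 < \<delta>" "E \<subseteq> cball 0 r" "0 \<le> r"
  shows "real (cover_num E \<delta>) \<le> (2 * r / \<delta> + 3)^2"
proof -
  obtain C :: "complex set" where C: "finite C" "real (card C) \<le> (2 * r / \<delta> + 3)^2" "E \<subseteq> (\<Union>c\<in>C. cball c \<delta>)"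
    using exists_finite_cover[OF assms] by blast
  have "cover_num E \<delta> \<le> card C" unfolding cover_num_def by (rule Least_le) (use C in blast)
  then show ?thesis using C(2) by linarith
qed

text \<open>No disc of radius \<open>\<delta>\<close> contains two of the separated points.
  Boundedness of \<open>E\<close> supplies a finite cover, so the \<open>LEAST\<close> in
  \<open>cover_num\<close> is attained.\<close>

lemma card_separated_le_cover_num:
  assumes \<delta>: "0 < \<delta>" and E: "E \<subseteq> cball 0 r" "0 \<le> r" and P: "P \<subseteq> E"
    and sep: "\<And>p q. p \<in> P \<Longrightarrow> q \<in> P \<Longrightarrow> p \<noteq> q \<Longrightarrow> 2 * \<delta> < dist p q"
  shows "card P \<le> cover_num E \<delta>"
proof -
  obtain C :: "complex set" where "finite C" "real (card C) \<le> (2 * r / \<delta> + 3)^2" "E \<subseteq> (\<Union>c\<in>C. cball c \<delta>)"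
    by (rule exists_finite_cover[OF \<delta> E])
  then have "\<exists>n. \<exists>C. finite C \<and> card C = n \<and> E \<subseteq> (\<Union>c\<in>C. cball c \<delta>)" by blast
  from LeastI_ex[OF this] obtain C where C: "finite C" "card C = cover_num E \<delta>" "E \<subseteq> (\<Union>c\<in>C. cball c \<delta>)"
    unfolding cover_num_def by blast
  have "\<forall>p\<in>P. \<exists>c\<in>C. p \<in> cball c \<delta>" using C P by blast
  then obtain k where k: "\<And>p. p \<in> P \<Longrightarrow> k p \<in> C" "\<And>p. p \<in> P \<Longrightarrow> p \<in> cball (k p) \<delta>" by metis
  have "inj_on k P"
  proof (rule inj_onI, rule ccontr)
    fix p q assume pq: "p \<in> P" "q \<in> P" "k p = k q" "p \<noteq> q"
    then have "dist (k p) p \<le> \<delta>" "dist (k p) q \<le> \<delta>" using k(2) by fastforce+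
    then have "dist p q \<le> 2 * \<delta>" using dist_triangle3[of p q "k p"] by linarith
    then show False using sep pq by force
  qed
  then have "card P \<le> card C" using C(1) k(1) by (intro card_inj_on_le[of k]) auto
  then show ?thesis using C by simp
qed

lemma upper_box_dim_bdd_le_2:
  assumes "E \<subseteq> cball 0 r" "0 < r"
  shows "upper_box_dim_bdd E \<le> 2"
  unfolding upper_box_dim_bdd_def
proof (rule order_trans[OF Limsup_mono])
  let ?g = "\<lambda>\<delta>. ereal (ln ((2 * r / \<delta> + 3)^2) / - ln \<delta>)"
  have "eventually (\<lambda>\<delta>::real. \<delta> \<in> {0<..<1}) (at_right 0)"
    by (rule eventually_at_right_real) simp
  then show "eventually (\<lambda>\<delta>. ereal (ln (real (cover_num E \<delta>)) / - ln \<delta>) \<le> ?g \<delta>) (at_right 0)"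
  proof eventually_elim
    case (elim \<delta>)
    have one: "1 \<le> (2 * r / \<delta> + 3)^2" using assms elim by (intro one_le_power) simp
    have le: "real (cover_num E \<delta>) \<le> (2 * r / \<delta> + 3)^2" by (rule cover_num_le) (use assms elim in auto)
    have "ln (real (cover_num E \<delta>)) \<le> ln ((2 * r / \<delta> + 3)^2)"
    \<comment> \<open>The empty set has cover number 0, and then \<open>ln 0 = 0\<close>.\<close>
    proof (cases "cover_num E \<delta> = 0")
      case True
      then show ?thesis using one by simp
    next
      case False
      then show ?thesis using one le by (intro ln_mono) auto
    qed
    moreover have "0 < - ln \<delta>" using elim by simp
    ultimately show ?case by (simp only: ereal_less_eq) (intro divide_right_mono, auto)
  qed
  have lim: "((\<lambda>\<delta>. ln ((2 * r / \<delta> + 3)^2) / - ln \<delta>) \<longlongrightarrow> 2) (at_right 0)"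
    using assms(2) by real_asymp
  have "Limsup (at_right 0) ?g = ereal 2"
    by (rule lim_imp_Limsup) (use lim in auto)
  then show "Limsup (at_right 0) ?g \<le> 2" by simp
qed

lemma upper_box_dim_le_2: "upper_box_dim E \<le> 2"
  unfolding upper_box_dim_def
proof (rule SUP_least)
  fix r :: real
  show "upper_box_dim_bdd (E \<inter> cball 0 r) \<le> 2"
    by (rule upper_box_dim_bdd_le_2[of _ "\<bar>r\<bar> + 1"]) auto
qed

text \<open>The scales \<open>r powr - (1 + \<epsilon>)\<close> tend to 0 and the quotient of
  logarithms tends to \<open>2 / (1 + \<epsilon>)\<close>. Arbitrarily large \<open>r\<close>
  suffice because the dimension is an upper limit.\<close>

lemma upper_box_dim_bdd_ge:
  assumes a: "0 < a" and \<epsilon>: "0 < \<epsilon>"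
    and big: "\<And>X. \<exists>r\<ge>X. (a * r - 1)^2 \<le> real (cover_num E (r powr - (1 + \<epsilon>)))"
  shows "ereal (2 / (1 + \<epsilon>)) \<le> upper_box_dim_bdd E"
  unfolding upper_box_dim_bdd_def
proof (rule dense_le)
  fix y assume y: "y < ereal (2 / (1 + \<epsilon>))"
  show "y \<le> Limsup (at_right 0) (\<lambda>\<delta>. ereal (ln (real (cover_num E \<delta>)) / - ln \<delta>))"
  proof (rule ccontr)
    assume "\<not> ?thesis"
    then have "Limsup (at_right 0) (\<lambda>\<delta>. ereal (ln (real (cover_num E \<delta>)) / - ln \<delta>)) < y" by simp
    then have "\<forall>\<^sub>F \<delta> in at_right 0. ereal (ln (real (cover_num E \<delta>)) / - ln \<delta>) < y"
      by (rule Limsup_lessD)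
    moreover have "filterlim (\<lambda>r. r powr - (1 + \<epsilon>)) (at_right 0) at_top"
      using \<epsilon> by real_asymp
    ultimately have "\<forall>\<^sub>F r in at_top. ereal (ln (real (cover_num E (r powr - (1 + \<epsilon>)))) / - ln (r powr - (1 + \<epsilon>))) < y"
      by (rule eventually_compose_filterlim)
    moreover have "((\<lambda>r. ln ((a * r - 1)^2) / - ln (r powr - (1 + \<epsilon>))) \<longlongrightarrow> 2 / (1 + \<epsilon>)) at_top"
      using a \<epsilon> by real_asymp (simp add: field_simps)
    then have "((\<lambda>r. ereal (ln ((a * r - 1)^2) / - ln (r powr - (1 + \<epsilon>)))) \<longlongrightarrow> ereal (2 / (1 + \<epsilon>))) at_top"
      by simp
    then have "\<forall>\<^sub>F r in at_top. y < ereal (ln ((a * r - 1)^2) / - ln (r powr - (1 + \<epsilon>)))"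
      using y by (rule order_tendstoD)
    moreover have "\<forall>\<^sub>F r in at_top. 1 < r \<and> 1 < a * r - 1"
      using a by (intro eventually_conj) real_asymp+
    ultimately have "\<forall>\<^sub>F r in at_top. (a * r - 1)^2 > real (cover_num E (r powr - (1 + \<epsilon>)))"
    proof eventually_elim
      case (elim r)
      show ?case
      proof (rule ccontr)
        assume "\<not> ?case"
        then have le: "(a * r - 1)^2 \<le> real (cover_num E (r powr - (1 + \<epsilon>)))" by simp
        have "0 < (a * r - 1)^2" using elim by simp
        then have "ln ((a * r - 1)^2) \<le> ln (real (cover_num E (r powr - (1 + \<epsilon>))))"
          using le by (intro ln_mono) auto
        moreover have "- ln (r powr - (1 + \<epsilon>)) = (1 + \<epsilon>) * ln r"
          using elim by (simp add: ln_powr algebra_simps)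
        then have "0 < - ln (r powr - (1 + \<epsilon>))" using elim \<epsilon> by simp
        ultimately have "ln ((a * r - 1)^2) / - ln (r powr - (1 + \<epsilon>)) \<le> ln (real (cover_num E (r powr - (1 + \<epsilon>)))) / - ln (r powr - (1 + \<epsilon>))"
          by (intro divide_right_mono) auto
        then have "ereal (ln ((a * r - 1)^2) / - ln (r powr - (1 + \<epsilon>))) \<le> ereal (ln (real (cover_num E (r powr - (1 + \<epsilon>)))) / - ln (r powr - (1 + \<epsilon>)))"
          by simp
        with elim(2) have "y < ereal (ln (real (cover_num E (r powr - (1 + \<epsilon>)))) / - ln (r powr - (1 + \<epsilon>)))"
          by (rule less_le_trans)
        then show False using less_asym[OF elim(1)] by blast
      qed
    qed
    then obtain X where "\<forall>r\<ge>X. (a * r - 1)^2 > real (cover_num E (r powr - (1 + \<epsilon>)))"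
      unfolding eventually_at_top_linorder by blast
    then show False using big by (metis not_le)
  qed
qed

section \<open>Periodicity of the exponential and backward invariance of the fast escaping
  set\<close>

lemma exp_shift: "exp (w + 2 * pi * \<i> * of_int m) = exp (w::complex)"
  using exp_plus_2pin[of w m] by (simp add: mult_ac)

lemma exists_shift_near:
  obtains m :: int where "norm (p + 2 * pi * \<i> * of_int m - w) \<le> \<bar>Re p - Re w\<bar> + pi"
proof -
  define t where "t = (Im w - Im p) / (2 * pi)"
  have "\<bar>of_int (round t) - t\<bar> \<le> 1/2" by (rule of_int_round_abs_le)
  then have "2 * pi * \<bar>of_int (round t) - t\<bar> \<le> pi" using pi_gt_zero by (simp add: mult_left_le)
  then have "\<bar>2 * pi * (of_int (round t) - t)\<bar> \<le> pi" by (simp add: abs_mult)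
  moreover have "2 * pi * t = Im w - Im p" by (simp add: t_def)
  then have "2 * pi * (of_int (round t) - t) = Im (p + 2 * pi * \<i> * of_int (round t) - w)"
    by (simp add: right_diff_distrib)
  ultimately have "\<bar>Im (p + 2 * pi * \<i> * of_int (round t) - w)\<bar> \<le> pi" by metis
  moreover have "Re (p + 2 * pi * \<i> * of_int (round t) - w) = Re p - Re w" by simp
  ultimately have "norm (p + 2 * pi * \<i> * of_int (round t) - w) \<le> \<bar>Re p - Re w\<bar> + pi"
    using cmod_le[of "p + 2 * pi * \<i> * of_int (round t) - w"] by linarith
  then show ?thesis using that by blast
qed

text \<open>The orbit of \<open>z\<close> is that of \<open>f z\<close> delayed by one step, which
  \<open>Suc L\<close> in place of \<open>L\<close> absorbs.\<close>

lemma A'_set_backward: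
  assumes "z \<in> D" "f z \<in> A'_set f D \<rho>"
  shows "z \<in> A'_set f D \<rho>"
proof -
  obtain L where L: "\<And>n. (f ^^ n) (f z) \<in> D"
      "\<And>n. (max_mod_tract f D ^^ n) \<rho> \<le> norm ((f ^^ (n + L)) (f z))"
    using assms(2) unfolding A'_set_def by auto
  have "(f ^^ n) z \<in> D" for n
    using assms(1) L(1)[of "n - 1"] by (cases n) (simp_all add: funpow_swap1)
  moreover have "(max_mod_tract f D ^^ n) \<rho> \<le> norm ((f ^^ (n + Suc L)) z)" for n
    using L(2)[of n] by (simp add: funpow_swap1)
  ultimately show ?thesis using assms(1) unfolding A'_set_def by blast
qed

context log_coordinates
begin

subsection \<open>Growth of the inverse branch\<close>

lemma norm_\<phi>: "T < Re w \<Longrightarrow> norm (\<phi> w) = exp (Re (G w))"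
  using exp_G by (metis norm_exp_eq_Re)

lemma G_inj: "T < Re p \<Longrightarrow> T < Re q \<Longrightarrow> G p = G q \<Longrightarrow> p = q"
  using \<phi>_inj exp_G by (metis inj_onD mem_Collect_eq)

lemma G_has_deriv: "T < Re w \<Longrightarrow> (G has_field_derivative deriv G w) (at w within S)"
  by (rule has_field_derivative_at_within[OF holomorphic_derivI[OF G_hol open_halfspace_Re_gt]]) simp

lemma G_lipschitz:
  assumes c: "T < c" "c \<le> Re p" "c \<le> Re q"
  shows "norm (G p - G q) \<le> K / c * norm (p - q)"
proof (rule field_differentiable_bound[OF convex_halfspace_Re_ge])
  fix w assume w: "w \<in> {w. Re w \<ge> c}"
  show "(G has_field_derivative deriv G w) (at w within {w. Re w \<ge> c})"
    by (rule G_has_deriv) (use w c in auto)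
  have "norm (deriv G w) \<le> K / Re w" using G_deriv w c by auto
  also have "\<dots> \<le> K / c" using w c T K by (intro divide_left_mono) auto
  finally show "norm (deriv G w) \<le> K / c" .
qed (use c in auto)

lemma half_ball_Re:
  assumes "p \<in> cball w (Re w / 2)"
  shows "Re w / 2 \<le> Re p"
  using assms complex_Re_le_cmod[of "w - p"] by (simp add: dist_norm)

text \<open>On the half disc the derivative is at most \<open>2 * K / Re w\<close>, and the radius
  is \<open>Re w / 2\<close>. Thus discs of unbounded size go into discs of the fixed radius
  \<open>K\<close>.\<close>

lemma G_half_ball:
  assumes w: "2 * T < Re w" and p: "p \<in> cball w (Re w / 2)"
  shows "norm (G p - G w) \<le> K"
proof -
  have "norm (G p - G w) \<le> K / (Re w / 2) * norm (p - w)"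
    by (rule G_lipschitz) (use w T half_ball_Re[OF p] in auto)
  also have "\<dots> \<le> K / (Re w / 2) * (Re w / 2)"
    using p w T K by (intro mult_left_mono) (auto simp: dist_norm norm_minus_commute)
  finally show ?thesis using w T by simp
qed

text \<open>This is properness of \<open>\<phi>\<close>. The condition is on \<open>norm w\<close>,
  so it serves for horizontal rays and for vertical translates alike.\<close>

lemma Re_G_large:
  obtains b where "\<And>w. T < Re w \<Longrightarrow> b < norm w \<Longrightarrow> x < Re (G w)"
proof -
  obtain b where b: "\<forall>w\<in>{w. T < Re w \<and> norm (\<phi> w) \<le> exp x}. norm w \<le> b"
    using \<phi>_proper[of "exp x"] unfolding bounded_iff by blast
  show ?thesis
  proof (rule that[of b])
    fix w assume "T < Re w" "b < norm w"
    then have "exp x < norm (\<phi> w)" using b by force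
    then show "x < Re (G w)" using norm_\<phi>[OF \<open>T < Re w\<close>] by simp
  qed
qed

lemma G_ray_deriv:
  assumes "T < Re w + t"
  shows "((\<lambda>t. G (w + of_real t)) has_vector_derivative deriv G (w + of_real t)) (at t within S)"
proof -
  have "((\<lambda>t. w + complex_of_real t) has_vector_derivative 1) (at t within S)"
    by (auto intro!: derivative_eq_intros)
  from field_vector_diff_chain_within[OF this G_has_deriv[of "w + of_real t"]] assms
  show ?thesis by (simp add: o_def)
qed

lemma G_ray_continuous:
  assumes "T < Re w"
  shows "continuous_on {0..} (\<lambda>t. G (w + of_real t))"
  unfolding continuous_on_eq_continuous_within
  by (intro ballI has_vector_derivative_continuous[OF G_ray_deriv]) (use assms in auto)

lemma G_ray_growth:
  assumes w: "T < Re w" and s: "0 \<le> s"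
  shows "norm (G (w + of_real s) - G w) \<le> K * ln ((Re w + s) / Re w)"
proof (cases "s = 0")
  case False
  have "norm (G (w + of_real s) - G (w + of_real 0)) \<le> K * ln (Re w + s) - K * ln (Re w + 0)"
  proof (rule differentiable_bound_general[where f = "\<lambda>t. G (w + of_real t)" and \<phi> = "\<lambda>t. K * ln (Re w + t)"])
    show "0 < s" using False s by simp
    show "continuous_on {0..s} (\<lambda>t. G (w + of_real t))"
      by (rule continuous_on_subset[OF G_ray_continuous[OF w]]) auto
    show "continuous_on {0..s} (\<lambda>t. K * ln (Re w + t))"
      using w T by (intro continuous_intros) auto
    fix t assume t: "0 < t" "t < s"
    show "((\<lambda>t. G (w + of_real t)) has_vector_derivative deriv G (w + of_real t)) (at t)"
      by (rule G_ray_deriv) (use t w in auto)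
    show "((\<lambda>t. K * ln (Re w + t)) has_vector_derivative K / (Re w + t)) (at t)"
      using t w T by (auto intro!: derivative_eq_intros simp flip: has_real_derivative_iff_has_vector_derivative)
    show "norm (deriv G (w + of_real t)) \<le> K / (Re w + t)"
      using G_deriv[of "w + of_real t"] t w by simp
  qed
  then show ?thesis using w T s by (simp add: ln_div algebra_simps)
qed simp

text \<open>\<open>Re G\<close> is unbounded on the ray, so the intermediate value theorem applies.
  As \<open>G\<close> grows at most logarithmically there, the point found is exponentially far to
  the right.\<close>

lemma ray_point:
  assumes w: "T < Re w" and x: "Re (G w) \<le> x"
  obtains s where "0 \<le> s" "Re (G (w + of_real s)) = x"
    "Re w * exp ((x - Re (G w)) / K) \<le> Re w + s"
proof -
  obtain b where b: "\<And>w. T < Re w \<Longrightarrow> b < norm w \<Longrightarrow> x < Re (G w)"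
    using Re_G_large by metis
  define S where "S = \<bar>b\<bar> + norm w + 1"
  have S: "0 \<le> S" by (simp add: S_def)
  have "S - norm w \<le> norm (w + of_real S)"
    using norm_triangle_ineq4[of "w + of_real S" w] S by simp
  then have "b < norm (w + of_real S)" by (simp add: S_def)
  then have gt: "x < Re (G (w + of_real S))" using b w S by simp
  have "\<exists>s. 0 \<le> s \<and> s \<le> S \<and> Re (G (w + of_real s)) = x"
  proof (rule IVT')
    show "Re (G (w + of_real 0)) \<le> x" using x by simp
    have "continuous_on {0..S} (\<lambda>t. G (w + of_real t))"
      by (rule continuous_on_subset[OF G_ray_continuous[OF w]]) auto
    then show "continuous_on {0..S} (\<lambda>t. Re (G (w + of_real t)))" by (rule continuous_on_Re)
  qed (use gt S in auto)
  then obtain s where s: "0 \<le> s" "Re (G (w + of_real s)) = x" by blast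
  have "x - Re (G w) \<le> norm (G (w + of_real s) - G w)"
    using s complex_Re_le_cmod[of "G (w + of_real s) - G w"] by simp
  also have "\<dots> \<le> K * ln ((Re w + s) / Re w)" by (rule G_ray_growth[OF w s(1)])
  finally have "(x - Re (G w)) / K \<le> ln ((Re w + s) / Re w)" using K by (simp add: field_simps)
  then have "exp ((x - Re (G w)) / K) \<le> (Re w + s) / Re w"
    using w T s by (subst (asm) ln_ge_iff) auto
  then have "Re w * exp ((x - Re (G w)) / K) \<le> Re w + s" using w T by (simp add: field_simps)
  then show ?thesis using that s by blast
qed

text \<open>If \<open>G'\<close> were smaller than an integrable power along a whole ray, then \<open>G\<close> would stay near its
  value at the starting point of the ray, contradicting properness of \<open>\<phi>\<close>.\<close>

lemma exists_large_deriv: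
  assumes \<epsilon>: "0 < \<epsilon>"
  obtains c X where "\<And>x. X \<le> x \<Longrightarrow> \<exists>w. T < Re w \<and> \<bar>Re (G w) - x\<bar> \<le> 1 \<and> exp ((x - c) / K) \<le> Re w \<and>
     Re w powr - (1 + \<epsilon>) \<le> norm (deriv G w)"
proof -
  define w0 where "w0 = complex_of_real (T + 1)"
  define c where "c = Re (G w0)"
  \<comment> \<open>The second term makes \<open>(Re p powr - \<epsilon>) / \<epsilon>\<close> at
    most 1/2 once \<open>Re p\<close> is at least \<open>exp ((x - c) / K)\<close>.\<close>
  define X where "X = max c (c + K * (ln (2 / \<epsilon>) / \<epsilon>))"
  have "\<exists>w. T < Re w \<and> \<bar>Re (G w) - x\<bar> \<le> 1 \<and> exp ((x - c) / K) \<le> Re w \<and>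
     Re w powr - (1 + \<epsilon>) \<le> norm (deriv G w)" if x: "X \<le> x" for x
  proof (rule ccontr)
    assume neg: "\<not> ?thesis"
    have "Re (G w0) \<le> x" using x by (simp add: X_def c_def)
    moreover have w0: "T < Re w0" by (simp add: w0_def)
    ultimately obtain s0 where s0: "0 \<le> s0" "Re (G (w0 + of_real s0)) = x"
      "Re w0 * exp ((x - Re (G w0)) / K) \<le> Re w0 + s0"
      using ray_point by metis
    define p where "p = w0 + of_real s0"
    have "exp ((x - c) / K) \<le> Re w0 * exp ((x - c) / K)"
      using mult_right_mono[of 1 "Re w0" "exp ((x - c) / K)"] w0 T by simp
    moreover have "Re p = Re w0 + s0" by (simp add: p_def)
    ultimately have "exp ((x - c) / K) \<le> Re p" using s0(3) unfolding c_def by linarith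
    then have p: "T < Re p" "Re (G p) = x" "exp ((x - c) / K) \<le> Re p"
      using s0(1,2) w0 by (auto simp: p_def)
    have small: "norm (deriv G (p + of_real s)) < (Re p + s) powr - (1 + \<epsilon>)"
      if s: "0 \<le> s" "norm (G (p + of_real s) - G p) \<le> 1" for s
    proof -
      have "\<bar>Re (G (p + of_real s)) - x\<bar> \<le> 1"
        using s(2) abs_Re_le_cmod[of "G (p + of_real s) - G p"] p by simp
      then show ?thesis using neg p s(1) by (auto simp: not_le dest!: spec[of _ "p + of_real s"])
    qed
    define Z where "Z = {s. 0 \<le> s \<and> 1 \<le> norm (G (p + of_real s) - G p)}"
    obtain s' where s': "0 \<le> s'" "Re (G (p + of_real s')) = x + 1"
      using ray_point[of p "x + 1"] p by auto
    have "s' \<in> Z" using s' p complex_Re_le_cmod[of "G (p + of_real s') - G p"] by (simp add: Z_def)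
    have "closed ({0..} \<inter> {s. 1 \<le> norm (G (p + of_real s) - G p)})"
    proof -
      have "continuous_on {0..} (\<lambda>s. norm (G (p + of_real s) - G p))"
        by (intro continuous_intros G_ray_continuous p)
      from continuous_closed_preimage[OF this, of "{1..}"] show ?thesis
        by (simp add: vimage_def)
    qed
    then have clZ: "closed Z" by (simp add: Z_def Collect_conj_eq atLeast_def)
    \<comment> \<open>First time the image of the ray leaves the open unit disc about
      \<open>G p\<close>. Until then the assumed smallness of the derivative applies; integrating it
      gives a displacement of at most 1/2 at \<open>s1\<close>, where it is at least 1.\<close>
    define s1 where "s1 = Inf Z"
    have bdd: "bdd_below Z" unfolding Z_def by (rule bdd_belowI[of _ 0]) auto
    have s1Z: "s1 \<in> Z" unfolding s1_def
      by (rule closed_contains_Inf) (use \<open>s' \<in> Z\<close> bdd clZ in auto)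
    have before: "norm (G (p + of_real s) - G p) \<le> 1" if "0 \<le> s" "s < s1" for s
    proof (rule ccontr)
      assume "\<not> ?thesis"
      then have "s \<in> Z" using that by (simp add: Z_def)
      then show False using that cInf_lower[OF _ bdd, of s] by (simp add: s1_def)
    qed
    have "s1 \<noteq> 0" using s1Z by (auto simp: Z_def)
    then have s1: "0 < s1" using s1Z by (auto simp: Z_def)
    have exponent: "- (1 + \<epsilon>) = - \<epsilon> - 1" by simp
    have "norm (G (p + of_real s1) - G (p + of_real 0)) \<le>
        - ((Re p + s1) powr - \<epsilon>) / \<epsilon> - (- ((Re p + 0) powr - \<epsilon>) / \<epsilon>)"
    proof (rule differentiable_bound_general[where f = "\<lambda>t. G (p + of_real t)" and \<phi> = "\<lambda>t. - ((Re p + t) powr - \<epsilon>) / \<epsilon>"])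
      show "continuous_on {0..s1} (\<lambda>t. G (p + of_real t))"
        by (rule continuous_on_subset[OF G_ray_continuous[OF p(1)]]) auto
      show "continuous_on {0..s1} (\<lambda>t. - ((Re p + t) powr - \<epsilon>) / \<epsilon>)"
        using p T \<epsilon> by (intro continuous_intros) auto
      fix t assume t: "0 < t" "t < s1"
      show "((\<lambda>t. G (p + of_real t)) has_vector_derivative deriv G (p + of_real t)) (at t)"
        by (rule G_ray_deriv) (use t p in auto)
      show "((\<lambda>t. - ((Re p + t) powr - \<epsilon>) / \<epsilon>) has_vector_derivative (Re p + t) powr - (1 + \<epsilon>)) (at t)"
        unfolding has_real_derivative_iff_has_vector_derivative[symmetric] exponent
        using t p T \<epsilon> by (auto intro!: derivative_eq_intros simp: algebra_simps)
      show "norm (deriv G (p + of_real t)) \<le> (Re p + t) powr - (1 + \<epsilon>)"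
        using small[of t] before[of t] t by simp
    qed (use s1 in simp)
    also have "\<dots> \<le> (Re p powr - \<epsilon>) / \<epsilon>" using \<epsilon> by simp
    also have "\<dots> \<le> 1 / 2"
    proof -
      have "ln (2 / \<epsilon>) / \<epsilon> \<le> (x - c) / K" using x K by (simp add: X_def field_simps)
      also have "(x - c) / K \<le> ln (Re p)" using p T by (subst ln_ge_iff) auto
      finally have "ln (2 / \<epsilon>) \<le> \<epsilon> * ln (Re p)" using \<epsilon> by (simp add: field_simps)
      then have "exp (- \<epsilon> * ln (Re p)) \<le> exp (- ln (2 / \<epsilon>))" by simp
      also have "\<dots> = \<epsilon> / 2" using \<epsilon> by (simp add: exp_minus)
      finally show ?thesis using p T \<epsilon> by (simp add: powr_def field_simps)
    qed
    finally show False using s1Z by (simp add: Z_def)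
  qed
  then show ?thesis using that by blast
qed

subsection \<open>Fast escaping points\<close>

text \<open>Logarithmic growth of \<open>G\<close> places maximum modulus points exponentially far
  to the right. The clause on \<open>C\<close> says that a gap between the logarithms of two radii
  does not shrink under \<open>max_mod_tract f D\<close>.\<close>

lemma max_mod_point:
  obtains X where "\<And>x. X \<le> x \<Longrightarrow> \<exists>v. T < Re v \<and> Re (G v) = x \<and> x \<le> Re v \<and>
    max_mod_tract f D (exp x) = exp (Re v) \<and>
    (\<forall>C\<ge>0. exp (Re v + C) \<le> max_mod_tract f D (exp (x + C)))"
proof -
  define w0 where "w0 = complex_of_real (T + 1)"
  define c where "c = Re (G w0)"
  have w0: "T < Re w0" "1 \<le> Re w0" using T by (auto simp: w0_def)
  have "eventually (\<lambda>x. c \<le> x \<and> K \<le> exp ((x - c) / K) \<and> x \<le> exp ((x - c) / K)) at_top"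
    using K by (intro eventually_conj) real_asymp+
  then obtain X where X: "\<And>x. X \<le> x \<Longrightarrow> c \<le> x \<and> K \<le> exp ((x - c) / K) \<and> x \<le> exp ((x - c) / K)"
    unfolding eventually_at_top_linorder by blast
  have below: "exp (Re v) \<le> max_mod_tract f D (exp (Re (G v)))" if "T < Re v" for v
    using max_mod_upper[OF \<phi>_mem[OF that]] f_\<phi>[OF that] norm_\<phi>[OF that] by simp
  have "\<exists>v. T < Re v \<and> Re (G v) = x \<and> x \<le> Re v \<and>
    max_mod_tract f D (exp x) = exp (Re v) \<and>
    (\<forall>C\<ge>0. exp (Re v + C) \<le> max_mod_tract f D (exp (x + C)))" if x: "X \<le> x" for x
  proof -
    obtain s where s: "0 \<le> s" "Re (G (w0 + of_real s)) = x" "Re w0 * exp ((x - c) / K) \<le> Re w0 + s"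
      using ray_point[OF w0(1), of x] X[OF x] unfolding c_def by metis
    define w where "w = w0 + of_real s"
    have w: "T < Re w" "Re (G w) = x" using s w0 by (auto simp: w_def)
    have "exp ((x - c) / K) \<le> Re w0 * exp ((x - c) / K)"
      using mult_right_mono[of 1 "Re w0" "exp ((x - c) / K)"] w0 by simp
    moreover have "Re w = Re w0 + s" by (simp add: w_def)
    ultimately have Rew: "exp ((x - c) / K) \<le> Re w" using s(3) by linarith
    obtain z where z: "z \<in> D" "norm z = norm (\<phi> w)" "max_mod_tract f D (norm (\<phi> w)) = norm (f z)"
      using max_mod_attained[OF \<phi>_mem[OF w(1)]] by blast
    have mm: "max_mod_tract f D (exp x) = norm (f z)" using z norm_\<phi>[OF w(1)] w(2) by simp
    have le_fz: "exp (Re w) \<le> norm (f z)" using below[OF w(1)] w(2) mm by simp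
    moreover have "exp T < exp (Re w)" using w by simp
    ultimately have "exp T < norm (f z)" by linarith
    then obtain v where v: "T < Re v" "\<phi> v = z" using \<phi>_onto[OF z(1)] by blast
    have fz: "norm (f z) = exp (Re v)" using f_\<phi>[OF v(1)] v(2) by simp
    have "exp (Re (G v)) = exp x" using norm_\<phi>[OF v(1)] v(2) z(2) norm_\<phi>[OF w(1)] w(2) by simp
    then have Gv: "Re (G v) = x" by simp
    have "Re w \<le> Re v" using le_fz fz by simp
    then have Rev: "exp ((x - c) / K) \<le> Re v" using Rew by linarith
    have "exp (Re v + C) \<le> max_mod_tract f D (exp (x + C))" if C: "0 \<le> C" for C
    proof -
      \<comment> \<open>Moving right until \<open>Re G\<close> has grown by \<open>C\<close>
        multiplies the real part by at least \<open>exp (C / K)\<close>, which adds at least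
        \<open>C\<close> since \<open>Re v \<ge> K\<close>.\<close>
      obtain t where t: "0 \<le> t" "Re (G (v + of_real t)) = x + C" "Re v * exp (C / K) \<le> Re v + t"
        using ray_point[OF v(1), of "x + C"] Gv C by auto
      have "K \<le> Re v" using X[OF x] Rev by linarith
      then have "K * (C / K) \<le> Re v * (C / K)" using C K by (intro mult_right_mono) auto
      then have "C \<le> Re v * (C / K)" using K by simp
      moreover have "Re v * (1 + C / K) \<le> Re v * exp (C / K)"
        using v T by (intro mult_left_mono exp_ge_add_one_self) auto
      ultimately have "Re v + C \<le> Re (v + of_real t)" using t(3) by (simp add: algebra_simps)
      then have "exp (Re v + C) \<le> exp (Re (v + of_real t))" by simp
      also have "\<dots> \<le> max_mod_tract f D (exp (x + C))"
        using below[of "v + of_real t"] t v by simp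
      finally show ?thesis .
    qed
    moreover have "x \<le> Re v" using X[OF x] Rev by linarith
    ultimately show ?thesis using v(1) Gv mm fz by auto
  qed
  then show ?thesis using that by blast
qed

text \<open>Pull back discs centred at points of maximum modulus; consecutive discs are aligned by a
  translation by a multiple of \<open>2\<pi>i\<close>, which \<open>exp\<close> does not see.\<close>

lemma shadowing:
  assumes big: "\<And>n. 2 * T < Re (w n)" "\<And>n. 2 * (K + pi) \<le> Re (w n)"
    and G: "\<And>n. Re (G (w (Suc n))) = Re (w n)"
  obtains u where "T < Re u" "\<And>n. (f ^^ n) (exp u) \<in> D"
    "\<And>n. exp (Re (w n) - (K + pi)) \<le> norm ((f ^^ n) (exp u))"
proof -
  have Kp: "0 \<le> K + pi" using K pi_gt_zero by linarith
  \<comment> \<open>\<open>K\<close> bounds the image of a disc under \<open>G\<close>, and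
    \<open>pi\<close> the error of the vertical alignment.\<close>
  define Q where "Q = (\<lambda>n. cball (w n) (K + pi))"
  have "\<exists>m::int. norm (G (w (Suc n)) + 2 * pi * \<i> * of_int m - w n) \<le> pi" for n
    using exists_shift_near[of "G (w (Suc n))" "w n"] G[of n] by auto
  then obtain m :: "nat \<Rightarrow> int" where m: "\<And>n. norm (G (w (Suc n)) + 2 * pi * \<i> * of_int (m n) - w n) \<le> pi"
    by metis
  define \<Gamma> where "\<Gamma> = (\<lambda>n p. G p + 2 * pi * \<i> * of_int (m n))"
  have QH: "T < Re p" if "p \<in> Q n" for p n
    using that half_ball_Re[of p "w n"] big[of n] by (auto simp: Q_def)
  have \<Gamma>Q: "\<Gamma> n p \<in> Q n" if p: "p \<in> Q (Suc n)" for n p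
  proof -
    have "p \<in> cball (w (Suc n)) (Re (w (Suc n)) / 2)"
      using p big(2)[of "Suc n"] by (auto simp: Q_def)
    then have "norm (G p - G (w (Suc n))) \<le> K" by (rule G_half_ball[OF big(1)])
    moreover have "\<Gamma> n p - w n = (G p - G (w (Suc n))) + (G (w (Suc n)) + 2 * pi * \<i> * of_int (m n) - w n)"
      by (simp add: \<Gamma>_def)
    ultimately have "norm (\<Gamma> n p - w n) \<le> K + pi"
      using m[of n] norm_triangle_mono by metis
    then show ?thesis by (simp add: Q_def dist_norm norm_minus_commute)
  qed
  have exp_\<Gamma>: "exp (\<Gamma> n p) = \<phi> p" if "T < Re p" for n p
    using exp_G[OF that] exp_shift by (simp add: \<Gamma>_def)
  \<comment> \<open>\<open>P n\<close> is the composition of \<open>\<Gamma> 0\<close>, ...,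
    \<open>\<Gamma> (n - 1)\<close>, with \<open>\<Gamma> 0\<close> applied last.\<close>
  define P where "P = rec_nat (\<lambda>p. p) (\<lambda>n q p. q (\<Gamma> n p))"
  have P: "P 0 p = p" "P (Suc n) p = P n (\<Gamma> n p)" for n p by (simp_all add: P_def)
  have cont: "continuous_on (Q n) (P n)" for n
  proof (induction n)
    case 0
    then show ?case by (simp add: P(1) continuous_on_id cong: continuous_on_cong)
  next
    case (Suc n)
    have "continuous_on (Q (Suc n)) G"
      by (rule continuous_on_subset[OF holomorphic_on_imp_continuous_on[OF G_hol]]) (use QH in auto)
    then have "continuous_on (Q (Suc n)) (\<Gamma> n)" unfolding \<Gamma>_def by (intro continuous_intros)
    then have "continuous_on (Q (Suc n)) (\<lambda>p. P n (\<Gamma> n p))"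
      by (rule continuous_on_compose2[OF Suc]) (use \<Gamma>Q in auto)
    then show ?case by (simp add: P(2) cong: continuous_on_cong)
  qed
  have iter: "(f ^^ n) (exp (P n v)) = exp v" if "v \<in> Q n" for n v
    using that
  proof (induction n arbitrary: v)
    case 0
    then show ?case by (simp add: P)
  next
    case (Suc n)
    have "(f ^^ Suc n) (exp (P (Suc n) v)) = f (exp (\<Gamma> n v))"
      using Suc.IH[OF \<Gamma>Q[OF Suc.prems]] by (simp add: P)
    also have "\<dots> = exp v" using exp_\<Gamma> f_\<phi> QH[OF Suc.prems] by simp
    finally show ?case .
  qed
  \<comment> \<open>The pulled-back discs are nested nonempty compact sets; the orbit of a common
    point follows the centres \<open>w n\<close>.\<close>
  have "(\<Inter>n. P n ` Q n) \<noteq> {}"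
  proof (rule compact_nest)
    show "compact (P n ` Q n)" for n
      by (rule compact_continuous_image[OF cont]) (simp add: Q_def)
    show "P n ` Q n \<noteq> {}" for n using Kp by (simp add: Q_def)
    show "P n ` Q n \<subseteq> P k ` Q k" if "k \<le> n" for k n
      using that
    proof (induction rule: dec_induct)
      case (step n)
      have "P (Suc n) ` Q (Suc n) \<subseteq> P n ` Q n" using \<Gamma>Q by (auto simp: P)
      then show ?case using step by blast
    qed simp
  qed
  then obtain u where u: "\<And>n. u \<in> P n ` Q n" by blast
  have shadow: "\<exists>v\<in>Q n. u = P n v" for n using u[of n] by blast
  show ?thesis
  proof (rule that[of u])
    show "T < Re u" using shadow[of 0] QH by (auto simp: P)
    show "(f ^^ n) (exp u) \<in> D" for n
    proof -
      \<comment> \<open>One level beyond \<open>n\<close> is needed: the iterate is then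
        \<open>exp (\<Gamma> n v) = \<phi> v\<close>, a point of \<open>D\<close>.\<close>
      obtain v where v: "v \<in> Q (Suc n)" "u = P (Suc n) v" using shadow by blast
      then have "(f ^^ n) (exp u) = exp (\<Gamma> n v)" using iter[OF \<Gamma>Q[OF v(1)]] by (simp add: P)
      then show ?thesis using exp_\<Gamma> \<phi>_mem QH[OF v(1)] by simp
    qed
    show "exp (Re (w n) - (K + pi)) \<le> norm ((f ^^ n) (exp u))" for n
    proof -
      obtain v where v: "v \<in> Q n" "u = P n v" using shadow by blast
      have "Re (w n) - Re v \<le> K + pi"
        using v(1) complex_Re_le_cmod[of "w n - v"] by (simp add: Q_def dist_norm)
      then show ?thesis using iter[OF v(1)] v(2) by simp
    qed
  qed
qed

lemma A'_set_nonempty: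
  obtains \<rho>0 where "\<And>\<rho>. \<rho>0 \<le> \<rho> \<Longrightarrow> \<exists>u. T < Re u \<and> exp u \<in> A'_set f D \<rho>"
proof -
  obtain X0 where X0: "\<And>x. X0 \<le> x \<Longrightarrow> \<exists>v. T < Re v \<and> Re (G v) = x \<and> x \<le> Re v \<and>
    max_mod_tract f D (exp x) = exp (Re v) \<and>
    (\<forall>C\<ge>0. exp (Re v + C) \<le> max_mod_tract f D (exp (x + C)))"
    using max_mod_point by metis
  define X where "X = max X0 (max (2 * T + 1) (2 * (K + pi)))"
  obtain v where v: "\<And>x. X \<le> x \<Longrightarrow> Re (G (v x)) = x" "\<And>x. X \<le> x \<Longrightarrow> x \<le> Re (v x)"
    "\<And>x. X \<le> x \<Longrightarrow> max_mod_tract f D (exp x) = exp (Re (v x))"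
    "\<And>x C. X \<le> x \<Longrightarrow> 0 \<le> C \<Longrightarrow> exp (Re (v x) + C) \<le> max_mod_tract f D (exp (x + C))"
  proof -
    have "\<forall>x. \<exists>v. X \<le> x \<longrightarrow> (T < Re v \<and> Re (G v) = x \<and> x \<le> Re v \<and>
    max_mod_tract f D (exp x) = exp (Re v) \<and>
    (\<forall>C\<ge>0. exp (Re v + C) \<le> max_mod_tract f D (exp (x + C))))"
      using X0 by (auto simp: X_def)
    from choice[OF this] show ?thesis using that by blast
  qed
  have "\<exists>u. T < Re u \<and> exp u \<in> A'_set f D \<rho>" if \<rho>: "exp X \<le> \<rho>" for \<rho>
  proof -
    have \<rho>0: "\<rho> > 0" using \<rho> exp_gt_zero[of X] by linarith
    then have ln\<rho>: "X \<le> ln \<rho>" using \<rho> by (simp add: ln_ge_iff)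
    \<comment> \<open>The start lies \<open>K + pi\<close> beyond \<open>ln \<rho>\<close>. This
      lead never shrinks along the orbit and pays for the loss in \<open>shadowing\<close>, so
      \<open>L = 0\<close> works.\<close>
    define w where "w = rec_nat (complex_of_real (ln \<rho> + (K + pi))) (\<lambda>n u. v (Re u))"
    have w: "w 0 = complex_of_real (ln \<rho> + (K + pi))" "w (Suc n) = v (Re (w n))" for n
      by (simp_all add: w_def)
    have Kp: "0 \<le> K + pi" using K pi_gt_zero by linarith
    have wX: "X \<le> Re (w n)" for n
    proof (induction n)
      case 0
      show ?case using ln\<rho> Kp by (simp add: w)
    next
      case (Suc n)
      then show ?case using v(2)[OF Suc] by (simp add: w)
    qed
    have below: "\<exists>y. (max_mod_tract f D ^^ n) \<rho> = exp y \<and> X \<le> y \<and> y + (K + pi) \<le> Re (w n)" for n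
    proof (induction n)
      case 0
      show ?case using ln\<rho> \<rho>0 by (intro exI[of _ "ln \<rho>"]) (simp add: w)
    next
      case (Suc n)
      then obtain y where y: "(max_mod_tract f D ^^ n) \<rho> = exp y" "X \<le> y" "y + (K + pi) \<le> Re (w n)"
        by blast
      have "exp (Re (v y) + (Re (w n) - y)) \<le> max_mod_tract f D (exp (y + (Re (w n) - y)))"
        by (rule v(4)) (use y Kp in linarith)+
      also have "\<dots> = exp (Re (w (Suc n)))" using v(3)[OF wX] by (simp add: w)
      finally have "Re (v y) + (K + pi) \<le> Re (w (Suc n))" using y(3) by simp
      then show ?case using y v(2,3)[OF y(2)] by (intro exI[of _ "Re (v y)"]) simp
    qed
    obtain u where u: "T < Re u" "\<And>n. (f ^^ n) (exp u) \<in> D"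
      "\<And>n. exp (Re (w n) - (K + pi)) \<le> norm ((f ^^ n) (exp u))"
    proof (rule shadowing)
      show "2 * T < Re (w n)" "2 * (K + pi) \<le> Re (w n)" for n using wX[of n] by (auto simp: X_def)
      show "Re (G (w (Suc n))) = Re (w n)" for n using v(1)[OF wX] by (simp add: w)
    qed blast
    have "(max_mod_tract f D ^^ n) \<rho> \<le> norm ((f ^^ (n + 0)) (exp u))" for n
    proof -
      obtain y where y: "(max_mod_tract f D ^^ n) \<rho> = exp y" "y + (K + pi) \<le> Re (w n)" using below by blast
      then have "exp y \<le> exp (Re (w n) - (K + pi))" by simp
      then have "exp y \<le> norm ((f ^^ n) (exp u))" using u(3)[of n] by linarith
      then show ?thesis using y(1) by simp
    qed
    then have "exp u \<in> A'_set f D \<rho>"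
      using u(2) u(2)[of 0] unfolding A'_set_def by (auto intro!: exI[of _ 0])
    then show ?thesis using u(1) by blast
  qed
  then show ?thesis using that by blast
qed

subsection \<open>Pulling back large discs\<close>

text \<open>The translates \<open>e + 2\<pi>ik\<close> of one point are mapped by \<open>G\<close> to a chain with bounded steps
  that tends to infinity; the translates of this chain are relatively dense.\<close>

lemma relatively_dense:
  assumes inv: "\<And>w. T < Re w \<Longrightarrow> exp w \<in> A \<Longrightarrow> \<phi> w \<in> A"
    and e: "T < Re e" "exp e \<in> A"
  obtains X where "\<And>w. X \<le> Re w \<Longrightarrow> \<exists>p. exp p \<in> A \<and> norm (p - w) \<le> 12 * K"
proof -
  define t where "t = (\<lambda>k::nat. e + 2 * pi * \<i> * of_int (int k))"
  have Re_t: "Re (t k) = Re e" for k by (simp add: t_def)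
  have tA: "\<phi> (t k) \<in> A" for k
    using inv[of "t k"] e Re_t exp_shift[of e "int k"] by (simp add: t_def)
  have step: "norm (G (t (Suc k)) - G (t k)) \<le> 8 * K" for k
  proof -
    have "norm (G (t (Suc k)) - G (t k)) \<le> K / Re e * norm (t (Suc k) - t k)"
      by (rule G_lipschitz) (use e Re_t in auto)
    also have "t (Suc k) - t k = 2 * pi * \<i>" by (simp add: t_def algebra_simps)
    also have "K / Re e * norm (2 * pi * \<i>) \<le> K * 8"
      using e T K pi_less_4 by (intro mult_mono) (auto simp: norm_mult divide_le_eq mult_le_cancel_left1)
    finally show ?thesis by (simp add: mult.commute)
  qed
  have "\<exists>p. exp p \<in> A \<and> norm (p - w) \<le> 12 * K" if w: "Re (G (t 0)) \<le> Re w" for w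
  proof -
    obtain b where b: "\<And>v. T < Re v \<Longrightarrow> b < norm v \<Longrightarrow> Re w < Re (G v)"
      using Re_G_large by metis
    obtain N :: nat where N: "b + norm e < real N" using reals_Archimedean2 by blast
    have "real N \<le> 2 * pi * real N" using pi_gt3 by (simp add: mult_le_cancel_right1)
    also have "\<dots> = norm (t N - e)" by (simp add: t_def norm_mult)
    also have "\<dots> \<le> norm (t N) + norm e" by (rule norm_triangle_ineq4)
    finally have "b < norm (t N)" using N by linarith
    then have ex: "Re w < Re (G (t N))" using b e Re_t by simp
    \<comment> \<open>First index at which the chain passes the real part of \<open>w\<close>; its
      predecessor is off by at most one step, \<open>8 * K\<close>. Vertical alignment costs a
      further \<open>pi < 4 * K\<close>.\<close>
    define k where "k = (LEAST k. Re w < Re (G (t k)))"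
    have k: "Re w < Re (G (t k))" unfolding k_def by (rule LeastI[of "\<lambda>k. Re w < Re (G (t k))", OF ex])
    then have "k \<noteq> 0" using w by (intro notI) simp
    then obtain j where j: "k = Suc j" using not0_implies_Suc by blast
    then have "\<not> Re w < Re (G (t j))" using not_less_Least[of j "\<lambda>k. Re w < Re (G (t k))"]
      by (simp add: k_def)
    moreover have "Re (G (t k)) - Re (G (t j)) \<le> 8 * K"
      using step[of j] complex_Re_le_cmod[of "G (t k) - G (t j)"] by (simp add: j)
    ultimately have close: "\<bar>Re (G (t j)) - Re w\<bar> \<le> 8 * K" using k by linarith
    obtain m :: int where "norm (G (t j) + 2 * pi * \<i> * of_int m - w) \<le> \<bar>Re (G (t j)) - Re w\<bar> + pi"
      using exists_shift_near by blast
    then have "norm (G (t j) + 2 * pi * \<i> * of_int m - w) \<le> 12 * K"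
      using close K pi_less_4 by linarith
    moreover have "exp (G (t j) + 2 * pi * \<i> * of_int m) \<in> A"
      using exp_shift exp_G[of "t j"] tA e Re_t by simp
    ultimately show ?thesis by blast
  qed
  then show ?thesis using that by blast
qed

text \<open>\<open>h\<close> leads from logarithmic coordinates to the plane of \<open>f\<close>,
  hence \<open>exp p\<close> is tested in the source and \<open>h p\<close> in the image.
  \<open>B\<close> and \<open>\<epsilon>\<close> stay fixed while \<open>Re w\<close> grows.\<close>

definition pullback :: "complex set \<Rightarrow> real \<Rightarrow> real \<Rightarrow> complex \<Rightarrow> (complex \<Rightarrow> complex) \<Rightarrow> bool" where
  "pullback A \<epsilon> B w h \<longleftrightarrow> h holomorphic_on ball w (Re w / 2) \<and> inj_on h (ball w (Re w / 2)) \<and>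
     h ` ball w (Re w / 2) \<subseteq> cball 0 B \<and> (\<forall>p\<in>ball w (Re w / 2). exp p \<in> A \<longrightarrow> h p \<in> A) \<and>
     Re w powr - (1 + \<epsilon>) \<le> norm (deriv h w)"

lemma half_ball_subset: "2 * T < Re w \<Longrightarrow> ball w (Re w / 2) \<subseteq> {w. T < Re w}"
  by (auto dest!: half_ball_Re[OF subsetD[OF ball_subset_cball]])

lemma pullback_base:
  assumes inv: "\<And>w. T < Re w \<Longrightarrow> exp w \<in> A \<Longrightarrow> \<phi> w \<in> A" and \<epsilon>: "0 < \<epsilon>"
  obtains w B where "X \<le> Re w" "pullback A \<epsilon> B w \<phi>"
proof -
  obtain c Y where cY: "\<And>x. Y \<le> x \<Longrightarrow> \<exists>w. T < Re w \<and> \<bar>Re (G w) - x\<bar> \<le> 1 \<and> exp ((x - c) / K) \<le> Re w \<and>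
     Re w powr - (1 + \<epsilon>) \<le> norm (deriv G w)"
    using exists_large_deriv[OF \<epsilon>] by metis
  have "eventually (\<lambda>x. Y \<le> x \<and> 1 \<le> x \<and> max X (2 * T + 1) \<le> exp ((x - c) / K)) at_top"
    using K by (intro eventually_conj) real_asymp+
  then obtain x where x: "Y \<le> x" "1 \<le> x" "max X (2 * T + 1) \<le> exp ((x - c) / K)"
    unfolding eventually_at_top_linorder by blast
  obtain w where w: "T < Re w" "\<bar>Re (G w) - x\<bar> \<le> 1" "exp ((x - c) / K) \<le> Re w"
     "Re w powr - (1 + \<epsilon>) \<le> norm (deriv G w)"
    using cY[OF x(1)] by blast
  have big: "X \<le> Re w" "2 * T < Re w" using w(3) x(3) by linarith+
  define S where "S = ball w (Re w / 2)"
  have S: "S \<subseteq> {w. T < Re w}" using half_ball_subset[OF big(2)] by (simp add: S_def)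
  have eG: "((\<lambda>z. exp (G z)) has_field_derivative exp (G z) * deriv G z) (at z)" if "T < Re z" for z
    using G_has_deriv[OF that] by (auto intro!: derivative_eq_intros)
  have d\<phi>: "(\<phi> has_field_derivative exp (G z) * deriv G z) (at z)" if "T < Re z" for z
    by (rule has_field_derivative_transform_within_open[OF eG[OF that] open_halfspace_Re_gt[of T]])
      (use that exp_G in auto)
  have "pullback A \<epsilon> (exp (Re (G w) + K)) w \<phi>"
    unfolding pullback_def S_def[symmetric]
  proof (intro conjI)
    show "\<phi> holomorphic_on S"
    proof (rule holomorphic_onI)
      fix z assume "z \<in> S"
      then have "T < Re z" using S by blast
      then show "\<phi> field_differentiable (at z within S)"
        using d\<phi> has_field_derivative_at_within field_differentiable_def by blast
    qed
    show "inj_on \<phi> S" using \<phi>_inj S inj_on_subset by blast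
    show "\<phi> ` S \<subseteq> cball 0 (exp (Re (G w) + K))"
    proof
      fix y assume "y \<in> \<phi> ` S"
      then obtain p where p: "p \<in> S" "y = \<phi> p" by blast
      have "norm (G p - G w) \<le> K" by (rule G_half_ball[OF big(2)]) (use p in \<open>auto simp: S_def\<close>)
      then have "Re (G p) \<le> Re (G w) + K" using complex_Re_le_cmod[of "G p - G w"] by simp
      moreover have "T < Re p" using p S by blast
      ultimately show "y \<in> cball 0 (exp (Re (G w) + K))" using norm_\<phi> p by simp
    qed
    show "\<forall>p\<in>S. exp p \<in> A \<longrightarrow> \<phi> p \<in> A" using inv S by blast
    \<comment> \<open>\<open>x \<ge> 1\<close> gives \<open>Re (G w) \<ge> 0\<close>, so passing
      from \<open>G\<close> to \<open>\<phi>\<close> does not decrease the derivative.\<close>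
    have "norm (deriv G w) \<le> exp (Re (G w)) * norm (deriv G w)"
      using w(2) x(2) by (auto simp: mult_le_cancel_right1)
    also have "\<dots> = norm (deriv \<phi> w)" using DERIV_imp_deriv[OF d\<phi>[OF w(1)]] by (simp add: norm_mult)
    finally show "Re w powr - (1 + \<epsilon>) \<le> norm (deriv \<phi> w)" using w(4) by linarith
  qed
  then show ?thesis using that big by blast
qed

text \<open>Precompose \<open>h\<close> with a translate of \<open>G\<close> at a far point
  \<open>v\<close> with \<open>Re (G v)\<close> near \<open>Re w\<close>. The whole half disc about
  \<open>v\<close> lands where \<open>h\<close> has bounded distortion, and the image stays in that
  of \<open>h\<close>, so \<open>B\<close> is kept.\<close>

lemma pullback_step:
  assumes inv: "\<And>w. T < Re w \<Longrightarrow> exp w \<in> A \<Longrightarrow> \<phi> w \<in> A" and \<epsilon>: "0 < \<epsilon>"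
  obtains X where "\<And>w h B. X \<le> Re w \<Longrightarrow> pullback A \<epsilon> B w h \<Longrightarrow>
    \<exists>w' h'. Re w + 1 \<le> Re w' \<and> pullback A \<epsilon> B w' h'"
proof -
  obtain c Y where cY: "\<And>x. Y \<le> x \<Longrightarrow> \<exists>w. T < Re w \<and> \<bar>Re (G w) - x\<bar> \<le> 1 \<and> exp ((x - c) / K) \<le> Re w \<and>
     Re w powr - (1 + \<epsilon> / 2) \<le> norm (deriv G w)"
    using exists_large_deriv[of "\<epsilon> / 2"] half_gt_zero[OF \<epsilon>] by metis
  define d where "d = distortion_radius / 2"
  have d: "0 < d" "d < 1 / 8" using distortion_radius by (auto simp: d_def)
  \<comment> \<open>\<open>5 + K\<close> bounds the distance of the image from \<open>w\<close>. In
    the last condition a spare power \<open>\<epsilon> / 2\<close> of the exponentially large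
    \<open>Re v\<close> absorbs the derivative of \<open>h\<close> and the distortion factor
    2.\<close>
  have "eventually (\<lambda>x. Y \<le> x \<and> 2 * T < x \<and> x + 1 \<le> exp ((x - c) / K) \<and> 5 + K < d * x \<and>
      2 * x powr (1 + \<epsilon>) \<le> exp ((x - c) / K) powr (\<epsilon> / 2)) at_top"
    using K d \<epsilon> by (intro eventually_conj) real_asymp+
  then obtain X where X: "\<And>x. X \<le> x \<Longrightarrow> Y \<le> x \<and> 2 * T < x \<and> x + 1 \<le> exp ((x - c) / K) \<and> 5 + K < d * x \<and>
      2 * x powr (1 + \<epsilon>) \<le> exp ((x - c) / K) powr (\<epsilon> / 2)"
    unfolding eventually_at_top_linorder by blast
  have "\<exists>w' h'. Re w + 1 \<le> Re w' \<and> pullback A \<epsilon> B w' h'" if w: "X \<le> Re w" and pb: "pullback A \<epsilon> B w h" for w h B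
  proof -
    define x where "x = Re w"
    have x: "Y \<le> x" "2 * T < x" "x + 1 \<le> exp ((x - c) / K)" "5 + K < d * x"
      "2 * x powr (1 + \<epsilon>) \<le> exp ((x - c) / K) powr (\<epsilon> / 2)"
      using X[OF w] by (auto simp: x_def)
    obtain v where v: "T < Re v" "\<bar>Re (G v) - x\<bar> \<le> 1" "exp ((x - c) / K) \<le> Re v"
      "Re v powr - (1 + \<epsilon> / 2) \<le> norm (deriv G v)"
      using cY[OF x(1)] by blast
    have Rev: "x + 1 \<le> Re v" using x(3) v(3) by linarith
    then have v2: "2 * T < Re v" using x(2) by linarith
    obtain m :: int where m: "norm (G v + 2 * pi * \<i> * of_int m - w) \<le> \<bar>Re (G v) - Re w\<bar> + pi"
      using exists_shift_near by blast
    define \<Gamma> where "\<Gamma> = (\<lambda>p. G p + 2 * pi * \<i> * of_int m)"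
    define S where "S = ball v (Re v / 2)"
    have S: "S \<subseteq> {w. T < Re w}" using half_ball_subset[OF v2] by (simp add: S_def)
    have \<Gamma>v: "norm (\<Gamma> v - w) \<le> 5" using m v(2) pi_less_4 by (simp add: \<Gamma>_def x_def)
    have \<Gamma>S: "\<Gamma> p \<in> ball w (d * x)" if p: "p \<in> S" for p
    proof -
      have "norm (G p - G v) \<le> K" by (rule G_half_ball[OF v2]) (use p in \<open>auto simp: S_def\<close>)
      moreover have "\<Gamma> p - w = (\<Gamma> v - w) + (G p - G v)" by (simp add: \<Gamma>_def)
      ultimately have "norm (\<Gamma> p - w) \<le> 5 + K" using norm_triangle_mono[OF \<Gamma>v] by metis
      then show ?thesis using x(4) by (simp add: dist_norm norm_minus_commute)
    qed
    have x0: "0 < x" using x(2) T by linarith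
    have "d * x \<le> x / 2" using d x0 by (simp add: mult_le_cancel_right2 field_simps)
    then have sub: "ball w (d * x) \<subseteq> ball w (Re w / 2)" by (intro subset_ball) (simp add: x_def)
    have d_eq: "d * x = distortion_radius * (Re w / 2)" by (simp add: d_def x_def)
    have h: "h holomorphic_on ball w (Re w / 2)" "inj_on h (ball w (Re w / 2))"
      "h ` ball w (Re w / 2) \<subseteq> cball 0 B" "\<And>p. p \<in> ball w (Re w / 2) \<Longrightarrow> exp p \<in> A \<Longrightarrow> h p \<in> A"
      "x powr - (1 + \<epsilon>) \<le> norm (deriv h w)"
      using pb unfolding pullback_def x_def by auto
    have \<Gamma>_hol: "\<Gamma> holomorphic_on S"
      unfolding \<Gamma>_def by (intro holomorphic_intros holomorphic_on_subset[OF G_hol S])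
    have vS: "v \<in> S" using v2 T by (simp add: S_def)
    have "pullback A \<epsilon> B v (h \<circ> \<Gamma>)"
      unfolding pullback_def S_def[symmetric]
    proof (intro conjI)
      show "h \<circ> \<Gamma> holomorphic_on S"
        by (rule holomorphic_on_compose_gen[OF \<Gamma>_hol h(1)]) (use \<Gamma>S sub in auto)
      have "inj_on \<Gamma> S"
        using G_inj S by (auto simp: inj_on_def \<Gamma>_def)
      then show "inj_on (h \<circ> \<Gamma>) S"
        by (rule comp_inj_on) (rule inj_on_subset[OF h(2)], use \<Gamma>S sub in auto)
      show "(h \<circ> \<Gamma>) ` S \<subseteq> cball 0 B" using h(3) \<Gamma>S sub by fastforce
      show "\<forall>p\<in>S. exp p \<in> A \<longrightarrow> (h \<circ> \<Gamma>) p \<in> A"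
      proof (intro ballI impI)
        fix p assume p: "p \<in> S" "exp p \<in> A"
        have "T < Re p" using p S by blast
        then have "exp (\<Gamma> p) \<in> A" using inv p exp_G exp_shift by (simp add: \<Gamma>_def)
        then show "(h \<circ> \<Gamma>) p \<in> A" using h(4) \<Gamma>S[OF p(1)] sub by auto
      qed
      have "deriv (h \<circ> \<Gamma>) v = deriv h (\<Gamma> v) * deriv \<Gamma> v"
      proof (rule deriv_chain)
        show "\<Gamma> field_differentiable at v"
          using \<Gamma>_hol vS by (auto simp: S_def intro: holomorphic_on_imp_differentiable_at)
        show "h field_differentiable at (\<Gamma> v)"
          by (rule holomorphic_on_imp_differentiable_at[OF h(1) open_ball subsetD[OF sub \<Gamma>S[OF vS]]])
      qed
      also have "deriv \<Gamma> v = deriv G v"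
        unfolding \<Gamma>_def using G_has_deriv[OF v(1)]
        by (intro DERIV_imp_deriv) (auto intro!: derivative_eq_intros)
      finally have dd: "norm (deriv (h \<circ> \<Gamma>) v) = norm (deriv h (\<Gamma> v)) * norm (deriv G v)"
        by (simp only: norm_mult)
      have "norm (deriv h w) / 2 \<le> norm (deriv h (\<Gamma> v))"
        by (rule univalent_deriv_lower[OF h(1) _ h(2)]) (use \<Gamma>S[OF vS, unfolded d_eq] x0 in \<open>simp_all add: x_def\<close>)
      then have half: "x powr - (1 + \<epsilon>) / 2 \<le> norm (deriv h (\<Gamma> v))" using h(5) by linarith
      have "2 * x powr (1 + \<epsilon>) \<le> Re v powr (\<epsilon> / 2)"
        using x(5) powr_mono2[of "\<epsilon> / 2" "exp ((x - c) / K)" "Re v"] v(3) \<epsilon> by simp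
      then have "inverse (Re v powr (\<epsilon> / 2)) \<le> inverse (2 * x powr (1 + \<epsilon>))"
        using x0 by (intro le_imp_inverse_le) auto
      also have "\<dots> = x powr - (1 + \<epsilon>) / 2" by (subst powr_minus) (simp add: field_simps)
      finally have "Re v powr - (\<epsilon> / 2) \<le> x powr - (1 + \<epsilon>) / 2"
        by (subst powr_minus)
      then have "Re v powr - (\<epsilon> / 2) * Re v powr - (1 + \<epsilon> / 2) \<le> norm (deriv h (\<Gamma> v)) * norm (deriv G v)"
        using half v(4) by (intro mult_mono) auto
      also have "Re v powr - (\<epsilon> / 2) * Re v powr - (1 + \<epsilon> / 2) = Re v powr - (1 + \<epsilon>)"
        unfolding powr_add[symmetric] by (rule arg_cong[where f = "\<lambda>e. Re v powr e"]) simp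
      finally show "Re v powr - (1 + \<epsilon>) \<le> norm (deriv (h \<circ> \<Gamma>) v)" by (simp add: dd)
    qed
    then show ?thesis using Rev by (auto simp: x_def)
  qed
  then show ?thesis using that by blast
qed

lemma exists_pullback:
  assumes inv: "\<And>w. T < Re w \<Longrightarrow> exp w \<in> A \<Longrightarrow> \<phi> w \<in> A" and \<epsilon>: "0 < \<epsilon>"
  obtains B where "\<And>X. \<exists>w h. X \<le> Re w \<and> pullback A \<epsilon> B w h"
proof -
  obtain X where X: "\<And>w h B. X \<le> Re w \<Longrightarrow> pullback A \<epsilon> B w h \<Longrightarrow>
    \<exists>w' h'. Re w + 1 \<le> Re w' \<and> pullback A \<epsilon> B w' h'"
    using pullback_step[OF assms] by blast
  obtain w0 B where w0: "X \<le> Re w0" "pullback A \<epsilon> B w0 \<phi>"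
    using pullback_base[OF assms] by blast
  have n: "\<exists>w h. X + real n \<le> Re w \<and> pullback A \<epsilon> B w h" for n
  proof (induction n)
    case 0
    then show ?case using w0 by auto
  next
    case (Suc n)
    then obtain w h where w: "X + real n \<le> Re w" "pullback A \<epsilon> B w h" by blast
    then obtain w' h' where "Re w + 1 \<le> Re w'" "pullback A \<epsilon> B w' h'" using X[of w B h] by auto
    then show ?case using w(1) by (intro exI[of _ w'] exI[of _ h']) auto
  qed
  have "\<exists>w h. Y \<le> Re w \<and> pullback A \<epsilon> B w h" for Y
  proof -
    obtain k :: nat where "Y - X \<le> real k" using real_arch_simple by blast
    then show ?thesis using n[of k] by (metis add.commute diff_le_eq order_trans)
  qed
  then show ?thesis using that by blast
qed

section \<open>Counting separated points and the lower bound for the dimension\<close>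

lemma pullback_cover_num:
  assumes dense: "\<And>w. X \<le> Re w \<Longrightarrow> \<exists>p. exp p \<in> A \<and> norm (p - w) \<le> 12 * K"
    and pb: "pullback A \<epsilon> B w h" and w: "X \<le> Re w" "1 \<le> Re w" "384 * K \<le> distortion_radius * Re w"
  shows "(distortion_radius / (384 * K) * Re w - 1)^2 \<le> real (cover_num (A \<inter> cball 0 B) (Re w powr - (1 + \<epsilon>)))"
proof -
  define r where "r = distortion_radius * (Re w / 2)"
  \<comment> \<open>With \<open>N\<close> nodes per side at spacing \<open>48 * K\<close>, the
    perturbed grid stays within \<open>distortion_radius * Re w / 4\<close> of
    \<open>w\<close>.\<close>
  define N where "N = nat \<lfloor>distortion_radius * Re w / (384 * K)\<rfloor>"
  define I where "I = {..<N} \<times> {..<N}"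
  \<comment> \<open>The grid extends to the right of \<open>w\<close>, so each node has real part at
    least \<open>X\<close> and \<open>dense\<close> applies.\<close>
  define ctr where "ctr = (\<lambda>(a::nat, b::nat). w + Complex (48 * K * a) (48 * K * b))"
  have N: "real N \<le> distortion_radius * Re w / (384 * K)" "distortion_radius * Re w / (384 * K) - 1 \<le> real N"
    using w K distortion_radius unfolding N_def by (auto; linarith)+
  have "\<exists>p. exp p \<in> A \<and> norm (p - ctr i) \<le> 12 * K" for i
    by (rule dense) (use w K in \<open>auto simp: ctr_def split: prod.splits intro: add_increasing2\<close>)
  then obtain p where p: "\<And>i. exp (p i) \<in> A" "\<And>i. norm (p i - ctr i) \<le> 12 * K" by metis
  have h: "h holomorphic_on ball w (Re w / 2)" "inj_on h (ball w (Re w / 2))"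
      "h ` ball w (Re w / 2) \<subseteq> cball 0 B" "\<And>p. p \<in> ball w (Re w / 2) \<Longrightarrow> exp p \<in> A \<Longrightarrow> h p \<in> A"
      "Re w powr - (1 + \<epsilon>) \<le> norm (deriv h w)"
    using pb unfolding pullback_def by auto
  have pr: "p i \<in> ball w r" if i: "i \<in> I" for i
  proof -
    obtain a b where ab: "i = (a, b)" "a < N" "b < N" using i by (auto simp: I_def)
    have "norm (ctr i - w) \<le> 48 * K * a + 48 * K * b"
      using cmod_le[of "ctr i - w"] K by (simp add: ctr_def ab)
    also have "\<dots> \<le> 48 * K * (real N - 1) + 48 * K * (real N - 1)"
      using ab K by (intro add_mono mult_left_mono) auto
    finally have "norm (p i - w) \<le> 12 * K + (48 * K * (real N - 1) + 48 * K * (real N - 1))"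
      using p(2)[of i] norm_triangle_mono[of "p i - ctr i" "12 * K" "ctr i - w"] by simp
    also have "\<dots> < 96 * K * real N" using K by (simp add: algebra_simps)
    also have "\<dots> \<le> distortion_radius * Re w / 4"
      using mult_left_mono[OF N(1), of "96 * K"] K by (simp add: field_simps)
    also have "\<dots> \<le> r" using distortion_radius w by (simp add: r_def)
    finally show ?thesis by (simp add: dist_norm norm_minus_commute)
  qed
  have "r \<le> Re w / 2" using distortion_radius w by (simp add: r_def mult_le_cancel_right1)
  then have sub: "ball w r \<subseteq> ball w (Re w / 2)" by (rule subset_ball)
  have sep: "2 * Re w powr - (1 + \<epsilon>) < dist (h (p i)) (h (p j))" if ij: "i \<in> I" "j \<in> I" "i \<noteq> j" for i j
  proof -
    obtain a b a' b' where ab: "i = (a, b)" "j = (a', b')" by (metis surj_pair)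
    have one: "1 \<le> \<bar>real m - real n\<bar>" if "m \<noteq> n" for m n :: nat using that by linarith
    have "48 * K \<le> norm (ctr i - ctr j)"
    proof (cases "a = a'")
      case True
      then have "1 \<le> \<bar>real b - real b'\<bar>" using ij(3) ab by (intro one) auto
      then have "48 * K * 1 \<le> 48 * K * \<bar>real b - real b'\<bar>" using K by (intro mult_left_mono) auto
      also have "\<dots> = \<bar>Im (ctr i - ctr j)\<bar>"
        using K by (simp add: ctr_def ab abs_mult flip: right_diff_distrib)
      also have "\<dots> \<le> norm (ctr i - ctr j)" by (rule abs_Im_le_cmod)
      finally show ?thesis by simp
    next
      case False
      then have "1 \<le> \<bar>real a - real a'\<bar>" by (rule one)
      then have "48 * K * 1 \<le> 48 * K * \<bar>real a - real a'\<bar>" using K by (intro mult_left_mono) auto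
      also have "\<dots> = \<bar>Re (ctr i - ctr j)\<bar>"
        using K by (simp add: ctr_def ab abs_mult flip: right_diff_distrib)
      also have "\<dots> \<le> norm (ctr i - ctr j)" by (rule abs_Re_le_cmod)
      finally show ?thesis by simp
    qed
    also have "ctr i - ctr j = (p i - p j) - (p i - ctr i) + (p j - ctr j)" by simp
    also have "norm \<dots> \<le> norm (p i - p j) + norm (p i - ctr i) + norm (p j - ctr j)"
      by (intro norm_triangle_le add_mono norm_triangle_ineq4) auto
    also have "\<dots> \<le> norm (p i - p j) + 12 * K + 12 * K" by (intro add_mono p(2)) simp
    \<comment> \<open>Spacing \<open>48 * K\<close> minus two errors of \<open>12 * K\<close>. Half
      of the derivative at \<open>w\<close> then separates the images by at least 12 times the
      scale, more than the factor 2 needed.\<close>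
    finally have far: "24 * K \<le> norm (p i - p j)" by simp
    have pos: "0 < Re w powr - (1 + \<epsilon>)" using w by simp
    have "Re w powr - (1 + \<epsilon>) / 2 * (24 * 1) \<le> norm (deriv h w) / 2 * norm (p i - p j)"
      using h(5) far K pos by (intro mult_mono) auto
    also have "\<dots> \<le> norm (h (p i) - h (p j))"
      by (rule univalent_separation[OF h(1) _ h(2)]) (use pr ij w in \<open>auto simp: r_def\<close>)
    finally show ?thesis using pos unfolding dist_norm by linarith
  qed
  define P where "P = (\<lambda>i. h (p i)) ` I"
  have "inj_on (\<lambda>i. h (p i)) I"
  proof (rule inj_onI, rule ccontr)
    fix i j assume "i \<in> I" "j \<in> I" "h (p i) = h (p j)" "i \<noteq> j"
    then have "2 * Re w powr - (1 + \<epsilon>) < 0" using sep[of i j] by simp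
    then show False using w by (simp add: not_less)
  qed
  then have cardP: "card P = N^2"
    unfolding P_def by (simp add: card_image I_def card_cartesian_product power2_eq_square)
  have "w \<in> ball w (Re w / 2)" using w(2) by simp
  then have "h w \<in> cball 0 B" using h(3) by blast
  then have B: "0 \<le> B" using norm_ge_zero order_trans unfolding mem_cball_0 by blast
  have "card P \<le> cover_num (A \<inter> cball 0 B) (Re w powr - (1 + \<epsilon>))"
  proof (rule card_separated_le_cover_num[OF _ _ B])
    show "P \<subseteq> A \<inter> cball 0 B"
    proof
      fix y assume "y \<in> P"
      then obtain i where i: "i \<in> I" "y = h (p i)" unfolding P_def by blast
      then have "p i \<in> ball w (Re w / 2)" using pr sub by blast
      then show "y \<in> A \<inter> cball 0 B" using h(3,4) p(1) i(2) by blast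
    qed
    show "2 * Re w powr - (1 + \<epsilon>) < dist x y" if "x \<in> P" "y \<in> P" "x \<noteq> y" for x y
      using that sep unfolding P_def by auto
  qed (use w in auto)
  then have "real N ^ 2 \<le> real (cover_num (A \<inter> cball 0 B) (Re w powr - (1 + \<epsilon>)))"
    unfolding cardP by (metis of_nat_le_iff of_nat_power)
  moreover have "(distortion_radius / (384 * K) * Re w - 1)^2 \<le> real N ^ 2"
  proof (rule power_mono)
    show "distortion_radius / (384 * K) * Re w - 1 \<le> real N" using N(2) by simp
    show "0 \<le> distortion_radius / (384 * K) * Re w - 1" using w(3) K by (simp add: field_simps)
  qed
  ultimately show ?thesis by linarith
qed

text \<open>Let \<open>\<epsilon>\<close> tend to 0. The radius \<open>B\<close> may depend on
  \<open>\<epsilon>\<close>, since the dimension is a supremum over bounded pieces.\<close>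

lemma upper_box_dim_ge_2:
  assumes inv: "\<And>w. T < Re w \<Longrightarrow> exp w \<in> A \<Longrightarrow> \<phi> w \<in> A"
    and e: "T < Re e" "exp e \<in> A"
  shows "2 \<le> upper_box_dim A"
proof -
  obtain X where X: "\<And>w. X \<le> Re w \<Longrightarrow> \<exists>p. exp p \<in> A \<and> norm (p - w) \<le> 12 * K"
    using relatively_dense[OF assms] by blast
  define a where "a = distortion_radius / (384 * K)"
  have a: "0 < a" using distortion_radius K by (simp add: a_def)
  have ge: "ereal (2 / (1 + \<epsilon>)) \<le> upper_box_dim A" if \<epsilon>: "0 < \<epsilon>" for \<epsilon>
  proof -
    obtain B where B: "\<And>X. \<exists>w h. X \<le> Re w \<and> pullback A \<epsilon> B w h"
      using exists_pullback[OF inv \<epsilon>] by blast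
    have "ereal (2 / (1 + \<epsilon>)) \<le> upper_box_dim_bdd (A \<inter> cball 0 B)"
    proof (rule upper_box_dim_bdd_ge[OF a \<epsilon>])
      fix Y
      obtain w h where w: "max (max X Y) (max 1 (1 / a)) \<le> Re w" "pullback A \<epsilon> B w h" using B by blast
      have "384 * K \<le> distortion_radius * Re w"
        using w(1) K distortion_radius by (simp add: a_def field_simps)
      then have "(a * Re w - 1)^2 \<le> real (cover_num (A \<inter> cball 0 B) (Re w powr - (1 + \<epsilon>)))"
        unfolding a_def by (intro pullback_cover_num[OF X w(2)]) (use w(1) in auto)
      then show "\<exists>r\<ge>Y. (a * r - 1)^2 \<le> real (cover_num (A \<inter> cball 0 B) (r powr - (1 + \<epsilon>)))"
        using w(1) by (intro exI[of _ "Re w"]) auto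
    qed
    also have "\<dots> \<le> upper_box_dim A" unfolding upper_box_dim_def by (rule SUP_upper) simp
    finally show ?thesis .
  qed
  have "((\<lambda>\<epsilon>. 2 / (1 + \<epsilon>)) \<longlongrightarrow> (2::real)) (at_right 0)" by real_asymp
  then have "((\<lambda>\<epsilon>. ereal (2 / (1 + \<epsilon>))) \<longlongrightarrow> ereal 2) (at_right 0)" by simp
  then have "ereal 2 \<le> upper_box_dim A"
  proof (rule tendsto_upperbound)
    show "\<forall>\<^sub>F \<epsilon> in at_right 0. ereal (2 / (1 + \<epsilon>)) \<le> upper_box_dim A"
      using ge by (auto simp: eventually_at_right_field intro: exI[of _ 1])
  qed simp
  then show ?thesis by simp
qed

end

section \<open>Both bounds combined for the fast escaping set\<close>

theorem theorem6p1:
  fixes f :: "complex \<Rightarrow> complex" and D :: "complex set" and R :: real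
  assumes "logarithmic_tract f D R"
  shows "\<exists>\<rho>0. \<forall>\<rho>\<ge>\<rho>0. \<rho> > 0 \<longrightarrow> upper_box_dim (A'_set f D \<rho>) = 2"
proof -
  obtain \<phi> G T K where "log_coordinates f D \<phi> G T K"
    using logarithmic_tract_coordinates[OF assms] by blast
  then interpret log_coordinates f D \<phi> G T K .
  obtain \<rho>0 where \<rho>0: "\<And>\<rho>. \<rho>0 \<le> \<rho> \<Longrightarrow> \<exists>u. T < Re u \<and> exp u \<in> A'_set f D \<rho>"
    using A'_set_nonempty by blast
  have "upper_box_dim (A'_set f D \<rho>) = 2" if \<rho>: "\<rho>0 \<le> \<rho>" for \<rho>
  proof (rule antisym[OF upper_box_dim_le_2])
    obtain u where u: "T < Re u" "exp u \<in> A'_set f D \<rho>" using \<rho>0[OF \<rho>] by blast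
    show "2 \<le> upper_box_dim (A'_set f D \<rho>)"
    proof (rule upper_box_dim_ge_2[OF _ u])
      fix w assume "T < Re w" "exp w \<in> A'_set f D \<rho>"
      then show "\<phi> w \<in> A'_set f D \<rho>" using A'_set_backward \<phi>_mem f_\<phi> by simp
    qed
  qed
  then show ?thesis by blast
qed

end
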